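(* Let $(X,d)$ be a complete metric space and let $\sigma\colon X\times X\times[0,1]\to X$ be a conical geodesic bicombing that has the midpoint property. Let $\{b_n\colon X^n\to X\}_{n\ge1}$ be the collection of maps constructed from $\sigma$ as described in the context. Then the map $\beta_\sigma\colon P_{\mathbb Q}(X)\to X$ given by the assignment $$\mu=\frac1n(\delta_{x_1}+\dots+\delta_{x_n})\longmapsto\lim_{k\to+\infty}b_{nk}\big(Q^k((x_1,\dots,x_n))\big)$$ is well-defined and extends uniquely to a contracting barycenter map $\beta_\sigma\colon P_1(X)\to X$ that has the following properties: (Locality) For all measures $\mu\in P_1(X)$ the point $\beta_\sigma(\mu)$ is contained in $\overline{\mathrm{conv}_\sigma}(\mathrm{spt}(\mu))$. (Equivariance) If $\phi\colon X\to X$ is a $1$-Lipschitz and $\sigma$-equivariant self-map of $(X,d)$, then $\phi\circ\beta_\sigma=\beta_\sigma\circ\phi_\ast$.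
   Context: Let $(X,d)$ be a metric space with Borel $\sigma$-algebra $\mathcal B_X$. Bicombings. A map $\sigma\colon X\times X\times[0,1]\to X$, written $\sigma_{xy}(t):=\sigma(x,y,t)$, is a conical geodesic bicombing if for all $x,y\in X$ one has $\sigma_{xy}(0)=x$, $\sigma_{xy}(1)=y$, $d(\sigma_{xy}(s),\sigma_{xy}(t))=|s-t|\,d(x,y)$ for all $s,t\in[0,1]$, and if $d(\sigma_{xy}(t),\sigma_{x'y'}(t))\le(1-t)d(x,x')+t\,d(y,y')$ for all $x,x',y,y'\in X$, $t\in[0,1]$. It has the midpoint property if $\sigma_{xy}(\tfrac12)=\sigma_{yx}(\tfrac12)$ for all $x,y\in X$. For $A\subset X$, put $A_1:=A$, $A_{k+1}:=\{\sigma_{xy}(t):x,y\in A_k,\ t\in[0,1]\}$, $\mathrm{conv}_\sigma(A):=\bigcup_{k\ge1}A_k$, and let $\overline{\mathrm{conv}_\sigma}(A)$ be the closure of $\mathrm{conv}_\sigma(A)$. A self-map $\phi\colon X\to X$ is $\sigma$-equivariant if $\phi\circ\sigma_{xy}=\sigma_{\phi(x)\phi(y)}$ for all $x,y\in X$. Measures. A Radon probability measure on $X$ is a Borel probability measure $\mu$ with $\mu(B)=\sup\{\mu(K):K\subset B,\ K\text{ compact}\}$ for all Borel sets $B$. $P_1(X)$ is the set of Radon probability measures $\mu$ on $X$ with finite first moment, i.e. $\int_Xd(x,x_0)\,\mu(dx)<+\infty$ for some $x_0\in X$. $P_1(X)$ carries the first Wasserstein distance $W^1(\mu,\nu)=\sup\{\int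 f\,d\mu-\int f\,d\nu: f\colon X\to\mathbb R\text{ is }1\text{-Lipschitz}\}$. $P_{\mathbb Q}(X)\subset P_1(X)$ is the set of measures $\sum_{k=1}^n\alpha_k\delta_{x_k}$ with $n\ge1$, $x_k\in X$, $\alpha_k\in\mathbb Q_{\ge0}$, $\sum_k\alpha_k=1$; every such measure can be written as $\frac1n(\delta_{x_1}+\dots+\delta_{x_n})$ for some $n$ and some (not necessarily distinct) points $x_i$. The support $\mathrm{spt}(\mu)$ is the set of $x\in X$ such that $\mu(U)>0$ for every open neighborhood $U$ of $x$. For a $1$-Lipschitz map $\phi\colon X\to X$, $\phi_\ast\colon P_1(X)\to P_1(X)$ is the pushforward, $\phi_\ast\mu(B)=\mu(\phi^{-1}(B))$. A contracting barycenter map on $X$ is a map $\beta\colon(P_1(X),W^1)\to(X,d)$ that is $1$-Lipschitz and satisfies $\beta(\delta_x)=x$ for all $x\in X$. The maps $b_n$ (for $X$ complete and $\sigma$ with the midpoint property). $b_1:=\mathrm{id}_X$ and $b_2(x,y):=\sigma_{xy}(\tfrac12)$. Given $b_n$ with $n\ge2$ and $\mathbf x\in X^{n+1}$, define $\mathbf x^{(1)}:=\mathbf x$ and $\mathbf x^{(k+1)}:=(b_n(\mathbf x^{(k)}_1),\dots,b_n(\mathbf x^{(k)}_{n+1}))$, where $\mathbf x^{(k)}_l\in X^n$ is obtained from $\mathbf x^{(k)}$ by deleting the $l$-th entry. The sequence $\mathbf x^{(k)}$ converges to a point of the form $(x^\infty,\dots,x^\infty)$, and $b_{n+1}(\mathbf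 x):=x^\infty$. For $\mathbf x\in X^n$ and $k\ge1$, $Q^k(\mathbf x)\in X^{kn}$ denotes the tuple $(\mathbf x,\dots,\mathbf x)$ ($k$ repetitions). *)

theory Defs
  imports "HOL-Probability.Probability"
begin

text \<open>
  The complete metric space \<open>(X, d)\<close> is rendered as a type of class \<^class>\<open>complete_space\<close>.
  A bicombing \<open>X \<times> X \<times> [0,1] \<rightarrow> X\<close> is a curried function whose last argument is a real;
  only its values for parameters in \<open>[0,1]\<close> are ever constrained or used.
\<close>

definition conical_geodesic_bicombing :: "('a::metric_space \<Rightarrow> 'a \<Rightarrow> real \<Rightarrow> 'a) \<Rightarrow> bool" where
  "conical_geodesic_bicombing \<sigma> \<longleftrightarrow>
     (\<forall>x y. \<sigma> x y 0 = x \<and> \<sigma> x y 1 = y) \<and>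
     (\<forall>x y. \<forall>s\<in>{0..1}. \<forall>t\<in>{0..1}. dist (\<sigma> x y s) (\<sigma> x y t) = \<bar>s - t\<bar> * dist x y) \<and>
     (\<forall>x y x' y'. \<forall>t\<in>{0..1}.
        dist (\<sigma> x y t) (\<sigma> x' y' t) \<le> (1 - t) * dist x x' + t * dist y y')"

definition midpoint_property :: "('a \<Rightarrow> 'a \<Rightarrow> real \<Rightarrow> 'a) \<Rightarrow> bool" where
  "midpoint_property \<sigma> \<longleftrightarrow> (\<forall>x y. \<sigma> x y (1/2) = \<sigma> y x (1/2))"

definition conv_step :: "('a \<Rightarrow> 'a \<Rightarrow> real \<Rightarrow> 'a) \<Rightarrow> 'a set \<Rightarrow> 'a set" where
  "conv_step \<sigma> A = {\<sigma> x y t | x y t. x \<in> A \<and> y \<in> A \<and> t \<in> {0..1}}"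

definition sigma_conv :: "('a \<Rightarrow> 'a \<Rightarrow> real \<Rightarrow> 'a) \<Rightarrow> 'a set \<Rightarrow> 'a set" where
  "sigma_conv \<sigma> A = (\<Union>k. (conv_step \<sigma> ^^ k) A)"

definition sigma_equivariant :: "('a \<Rightarrow> 'a \<Rightarrow> real \<Rightarrow> 'a) \<Rightarrow> ('a \<Rightarrow> 'a) \<Rightarrow> bool" where
  "sigma_equivariant \<sigma> \<phi> \<longleftrightarrow> (\<forall>x y. \<forall>t\<in>{0..1}. \<phi> (\<sigma> x y t) = \<sigma> (\<phi> x) (\<phi> y) t)"

definition radon_prob :: "'a::topological_space measure \<Rightarrow> bool" where
  "radon_prob \<mu> \<longleftrightarrow> prob_space \<mu> \<and> sets \<mu> = sets borel \<and>
     (\<forall>B\<in>sets borel. emeasure \<mu> B = (SUP K\<in>{K. compact K \<and> K \<subseteq> B}. emeasure \<mu> K))"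

definition P1 :: "'a::metric_space measure set" where
  "P1 = {\<mu>. radon_prob \<mu> \<and> (\<exists>x0. integrable \<mu> (\<lambda>x. dist x x0))}"

text \<open>The supremum is a real one; it is finite for measures in \<open>P1\<close>, the only ones it is used for.\<close>

definition W1 :: "'a::metric_space measure \<Rightarrow> 'a measure \<Rightarrow> real" where
  "W1 \<mu> \<nu> = (SUP f\<in>{f :: 'a \<Rightarrow> real. 1-lipschitz_on UNIV f}.
     integral\<^sup>L \<mu> f - integral\<^sup>L \<nu> f)"

text \<open>The Dirac measure at \<open>x\<close> is \<open>return borel x\<close>.\<close>

definition dirac_comb :: "nat \<Rightarrow> (nat \<Rightarrow> real) \<Rightarrow> (nat \<Rightarrow> 'a::topological_space) \<Rightarrow> 'a measure" where
  "dirac_comb n \<alpha> x = measure_of UNIV (sets borel)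
     (\<lambda>B. \<Sum>k<n. ennreal (\<alpha> k) * emeasure (return borel (x k)) B)"

definition PQ :: "'a::topological_space measure set" where
  "PQ = {dirac_comb n \<alpha> x | n \<alpha> x.
     n \<ge> 1 \<and> (\<forall>k<n. \<alpha> k \<in> \<rat> \<and> 0 \<le> \<alpha> k) \<and> (\<Sum>k<n. \<alpha> k) = 1}"

definition empirical :: "'a::topological_space list \<Rightarrow> 'a measure" where
  "empirical xs = dirac_comb (length xs) (\<lambda>_. 1 / real (length xs)) (\<lambda>i. xs ! i)"

definition spt :: "'a::topological_space measure \<Rightarrow> 'a set" where
  "spt \<mu> = {x. \<forall>U. open U \<and> x \<in> U \<longrightarrow> emeasure \<mu> U > 0}"

definition contracting_barycenter_map :: "('a::metric_space measure \<Rightarrow> 'a) \<Rightarrow> bool" where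
  "contracting_barycenter_map \<beta> \<longleftrightarrow>
     (\<forall>\<mu>\<in>P1. \<forall>\<nu>\<in>P1. dist (\<beta> \<mu>) (\<beta> \<nu>) \<le> W1 \<mu> \<nu>) \<and> (\<forall>x. \<beta> (return borel x) = x)"

lemma sets_dirac_comb [simp]: "sets (dirac_comb n \<alpha> x) = sets borel"
  unfolding dirac_comb_def using sets.sigma_sets_eq[of borel] by simp

lemma space_dirac_comb [simp]: "space (dirac_comb n \<alpha> x) = UNIV"
  unfolding dirac_comb_def by simp

lemma emeasure_dirac_comb:
  assumes "B \<in> sets borel"
  shows "emeasure (dirac_comb n \<alpha> x) B = (\<Sum>k<n. ennreal (\<alpha> k) * indicator B (x k))"
proof -
  let ?m = "\<lambda>B. \<Sum>k<n. ennreal (\<alpha> k) * emeasure (return borel (x k)) B"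
  have "countably_additive (sets borel) ?m"
  proof (rule countably_additiveI)
    fix A :: "nat \<Rightarrow> 'a set"
    assume A: "range A \<subseteq> sets borel" "disjoint_family A"
    have "(\<Sum>i. ?m (A i)) = (\<Sum>k<n. \<Sum>i. ennreal (\<alpha> k) * emeasure (return borel (x k)) (A i))"
      by (rule suminf_sum) simp
    also have "\<dots> = ?m (\<Union>i. A i)"
      using A by (intro sum.cong refl) (simp add: suminf_indicator)
    finally show "(\<Sum>i. ?m (A i)) = ?m (\<Union>i. A i)" .
  qed
  moreover have "positive (sets borel) ?m"
    by (simp add: positive_def)
  moreover have "sigma_algebra UNIV (sets (borel :: 'a measure))"
    using sets.sigma_algebra_axioms[of "borel :: 'a measure"] by simp
  ultimately have "emeasure (dirac_comb n \<alpha> x) B = ?m B"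
    unfolding dirac_comb_def using assms by (intro emeasure_measure_of_sigma)
  then show ?thesis
    using assms by simp
qed

lemma empirical_in_PQ:
  assumes "xs \<noteq> []"
  shows "empirical xs \<in> PQ"
proof -
  have "1 \<le> length xs"
    using assms by (cases xs) auto
  moreover have "(\<Sum>k<length xs. 1 / real (length xs)) = 1"
    using assms by simp
  moreover have "1 / real (length xs) \<in> \<rat>" "0 \<le> 1 / real (length xs)"
    by simp_all
  ultimately show ?thesis
    unfolding PQ_def empirical_def by blast
qed

text \<open>Tuples in \<open>X\<^sup>n\<close> are lists of length \<open>n\<close>; entries are indexed from 0.\<close>

definition delete_entry :: "nat \<Rightarrow> 'a list \<Rightarrow> 'a list" where
  "delete_entry l xs = take l xs @ drop (Suc l) xs"

definition delete_step :: "('a list \<Rightarrow> 'a) \<Rightarrow> 'a list \<Rightarrow> 'a list" where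
  "delete_step b xs = map (\<lambda>l. b (delete_entry l xs)) [0..<length xs]"

definition diagonal_limit :: "nat \<Rightarrow> (nat \<Rightarrow> 'a::topological_space list) \<Rightarrow> 'a" where
  "diagonal_limit n X = (THE p. \<forall>i<n. (\<lambda>k. X k ! i) \<longlonglongrightarrow> p)"

text \<open>\<open>bmap \<sigma> n\<close> is meaningful on lists of length \<open>n \<ge> 1\<close> only; its value for \<open>n = 0\<close> is junk.\<close>

fun bmap :: "('a::topological_space \<Rightarrow> 'a \<Rightarrow> real \<Rightarrow> 'a) \<Rightarrow> nat \<Rightarrow> 'a list \<Rightarrow> 'a" where
  "bmap \<sigma> 0 = undefined"
| "bmap \<sigma> (Suc 0) = (\<lambda>xs. xs ! 0)"
| "bmap \<sigma> (Suc (Suc 0)) = (\<lambda>xs. \<sigma> (xs ! 0) (xs ! 1) (1/2))"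
| "bmap \<sigma> (Suc (Suc (Suc n))) = (\<lambda>xs. diagonal_limit (Suc (Suc (Suc n)))
     (\<lambda>k. (delete_step (bmap \<sigma> (Suc (Suc n))) ^^ k) xs))"

definition Qrep :: "nat \<Rightarrow> 'a list \<Rightarrow> 'a list" where
  "Qrep k xs = concat (replicate k xs)"

definition bseq :: "('a::topological_space \<Rightarrow> 'a \<Rightarrow> real \<Rightarrow> 'a) \<Rightarrow> 'a list \<Rightarrow> nat \<Rightarrow> 'a" where
  "bseq \<sigma> xs k = bmap \<sigma> (length xs * k) (Qrep k xs)"

end

theory Submission
  imports Defs "HOL-Combinatorics.Cycles"
begin

text \<open>
  Each map \<open>b\<^sub>n\<close> is symmetric, idempotent and contracting: \<open>n\<close> times the distance of two values is at
  most the sum of the distances of corresponding entries. These three properties pass from \<open>b\<^sub>n\<close> to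
  \<open>b\<^sub>n\<^sub>+\<^sub>1\<close>, because deleting two different entries leaves tuples that differ in one place only, so
  that the iteration defining \<open>b\<^sub>n\<^sub>+\<^sub>1\<close> shrinks the spread by the factor \<open>1/n\<close>
  (\<open>contracting_mean_iterated\<close>).

  The iteration does not change its own limit, so the contraction property bounds the
  distance from \<open>b\<^sub>n\<^sub>+\<^sub>1(x)\<close> to any point by the average of the distances from the values of \<open>b\<^sub>n\<close> on
  the tuples with one entry deleted (\<open>bmap_dist_point\<close>). Going down from \<open>nK\<close> to \<open>nk\<close> entries, the
  value of \<open>b\<close> on \<open>K\<close> copies of a tuple is compared with its values on random subtuples of size
  \<open>nk\<close>, drawn without replacement. Such a subtuple contains every point with nearly the same
  frequency as the original tuple does; the variance telescopes and is of order \<open>1/k\<close>. Hence these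
  values are close to the value on \<open>k\<close> copies, and the sequence defining the barycenter of an
  empirical measure is Cauchy, with error of order \<open>1/\<surd>k\<close> (\<open>bseq_dist_le\<close>).

  Two tuples of equal length have barycenters no farther apart than the average cost of an
  optimal assignment of their entries. By duality (\<open>optimal_assignment_duality\<close>) this cost
  is attained by a single \<open>1\<close>-Lipschitz function, so it is bounded by the Wasserstein distance of the
  two empirical measures. Repeating entries reduces the case of different lengths to this
  one. It follows at once that the barycenter depends on the measure only.

  Finally, empirical measures are dense in \<open>P\<^sub>1(X)\<close>, and a Radon measure can even be approximated by
  empirical measures on its own support (\<open>empirical_approximation\<close>). Completeness of \<open>X\<close> then gives the
  extension, density its uniqueness and equivariance, and the control of the supports
  its locality.
\<close>

section \<open>Symmetric contracting means of tuples\<close>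

definition tuple_dist :: "'a::metric_space list \<Rightarrow> 'a list \<Rightarrow> real" where
  "tuple_dist xs ys = (\<Sum>(x, y)\<leftarrow>zip xs ys. dist x y)"

text \<open>
  The properties of the maps \<open>b\<^sub>n\<close> that survive the passage from \<open>n\<close> to \<open>n + 1\<close>. Symmetry has to be part of
  the induction: it is what allows two tuples to be compared after a favourable reordering of
  their entries.
\<close>

definition contracting_mean :: "nat \<Rightarrow> ('a::metric_space list \<Rightarrow> 'a) \<Rightarrow> bool" where
  "contracting_mean n b \<longleftrightarrow>
     (\<forall>xs ys. length xs = n \<and> mset xs = mset ys \<longrightarrow> b xs = b ys) \<and>
     (\<forall>xs ys. length xs = n \<and> length ys = n \<longrightarrow> real n * dist (b xs) (b ys) \<le> tuple_dist xs ys) \<and>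
     (\<forall>x. b (replicate n x) = x)"

lemma tuple_dist_simps [simp]:
  "tuple_dist [] ys = 0"
  "tuple_dist (x # xs) (y # ys) = dist x y + tuple_dist xs ys"
  by (simp_all add: tuple_dist_def)

lemma tuple_dist_conv_sum:
  assumes "length xs = n" "length ys = n"
  shows "tuple_dist xs ys = (\<Sum>i<n. dist (xs ! i) (ys ! i))"
  unfolding tuple_dist_def using assms
  by (simp add: sum_list_sum_nth atLeast0LessThan split: prod.splits)

lemma tuple_dist_replicate:
  "tuple_dist xs (replicate (length xs) z) = (\<Sum>x\<leftarrow>xs. dist x z)"
  by (induction xs) auto

lemma tuple_dist_self [simp]: "tuple_dist xs xs = 0"
  by (induction xs) auto

lemma tuple_dist_append:
  "length xs = length xs' \<Longrightarrow> tuple_dist (xs @ ys) (xs' @ ys') = tuple_dist xs xs' + tuple_dist ys ys'"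
  by (simp add: tuple_dist_def)

lemma length_delete_entry: "l < length xs \<Longrightarrow> length (delete_entry l xs) = length xs - 1"
  by (simp add: delete_entry_def)

lemma mset_delete_entry:
  assumes "l < length xs"
  shows "mset (delete_entry l xs) = mset xs - {#xs ! l#}"
proof -
  have "mset xs = mset (take l xs @ xs ! l # drop (Suc l) xs)"
    using assms by (simp add: id_take_nth_drop[symmetric])
  then show ?thesis
    by (simp add: delete_entry_def)
qed

lemma set_delete_entry_subset: "set (delete_entry l xs) \<subseteq> set xs"
  unfolding delete_entry_def using set_take_subset set_drop_subset by fastforce

lemma map_delete_entry: "map f (delete_entry l xs) = delete_entry l (map f xs)"
  by (simp add: delete_entry_def take_map drop_map)

lemma tuple_dist_delete_entry:
  assumes "length xs = length ys" "l < length xs"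
  shows "tuple_dist (delete_entry l xs) (delete_entry l ys) = tuple_dist xs ys - dist (xs ! l) (ys ! l)"
proof -
  have "tuple_dist xs ys = tuple_dist (take l xs @ xs ! l # drop (Suc l) xs) (take l ys @ ys ! l # drop (Suc l) ys)"
    using assms by (simp add: id_take_nth_drop[symmetric])
  also have "\<dots> = tuple_dist (delete_entry l xs) (delete_entry l ys) + dist (xs ! l) (ys ! l)"
    using assms by (simp add: delete_entry_def tuple_dist_append)
  finally show ?thesis by simp
qed

lemma delete_entry_replicate: "l < Suc n \<Longrightarrow> delete_entry l (replicate (Suc n) x) = replicate n x"
  by (simp add: delete_entry_def replicate_add[symmetric] del: replicate_Suc)

lemma length_delete_step [simp]: "length (delete_step b xs) = length xs"
  by (simp add: delete_step_def)

lemma length_delete_step_funpow [simp]: "length ((delete_step b ^^ k) xs) = length xs"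
  by (induction k) auto

lemma delete_step_nth: "l < length xs \<Longrightarrow> delete_step b xs ! l = b (delete_entry l xs)"
  by (simp add: delete_step_def)

context
  fixes n :: nat and b :: "'a::complete_space list \<Rightarrow> 'a"
  assumes mean: "contracting_mean n b"
begin

lemma mean_sym: "length xs = n \<Longrightarrow> mset xs = mset ys \<Longrightarrow> b xs = b ys"
  and mean_dist: "length xs = n \<Longrightarrow> length ys = n \<Longrightarrow> real n * dist (b xs) (b ys) \<le> tuple_dist xs ys"
  and mean_replicate: "b (replicate n x) = x"
  using mean unfolding contracting_mean_def by blast+

text \<open>
  A point is the mean of its constant tuple, so comparing with constant tuples turns the contraction
  property into a Jensen inequality for the convex function \<open>dist _ z\<close>.
\<close>

lemma mean_dist_point:
  assumes "length xs = n"
  shows "real n * dist (b xs) z \<le> (\<Sum>x\<leftarrow>xs. dist x z)"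
  using mean_dist[of xs "replicate n z"] assms tuple_dist_replicate[of xs z]
  by (simp add: mean_replicate)

lemma mean_dist_point_le:
  assumes "length xs = n" "n > 0" "\<And>x. x \<in> set xs \<Longrightarrow> dist x z \<le> r"
  shows "dist (b xs) z \<le> r"
proof -
  have "real n * dist (b xs) z \<le> (\<Sum>x\<leftarrow>xs. dist x z)"
    by (rule mean_dist_point) fact
  also have "\<dots> \<le> (\<Sum>x\<leftarrow>xs. r)"
    using assms(3) by (intro sum_list_mono)
  also have "\<dots> = real n * r"
    using assms(1) by (simp add: sum_list_triv)
  finally show ?thesis using \<open>n > 0\<close> by simp
qed

end

lemma sum_list_map_conv_sum: "(\<Sum>x\<leftarrow>xs. f x) = (\<Sum>i<length xs. f (xs ! i))"
  by (simp add: sum_list_sum_nth atLeast0LessThan)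

text \<open>
  The limits in the construction, of iterated means, of means of repeated tuples and of barycenters
  along approximating measures, all come with a bound between a term and every later one.
\<close>

lemma convergent_if_tail_bound:
  fixes X :: "nat \<Rightarrow> 'a::complete_space"
  assumes tail: "\<And>k m. k \<ge> k\<^sub>0 \<Longrightarrow> dist (X (k + m)) (X k) \<le> f k" and f: "f \<longlonglongrightarrow> 0"
  shows "convergent X"
proof -
  have "Cauchy X"
  proof (rule metric_CauchyI)
    fix e :: real assume "e > 0"
    then have "eventually (\<lambda>k. f k < e / 2 \<and> k \<ge> k\<^sub>0) sequentially"
      using order_tendstoD(2)[OF f, of "e/2"] by (intro eventually_conj eventually_ge_at_top) simp
    then obtain k where k: "f k < e / 2" "k \<ge> k\<^sub>0"
      unfolding eventually_sequentially by blast
    have "dist (X m) (X m') < e" if "m \<ge> k" "m' \<ge> k" for m m'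
      using tail[of k "m - k"] tail[of k "m' - k"] that k
        dist_triangle2[of "X m" "X m'" "X k"] by simp
    then show "\<exists>M. \<forall>m\<ge>M. \<forall>n\<ge>M. dist (X m) (X n) < e" by blast
  qed
  then show ?thesis by (rule Cauchy_convergent)
qed

text \<open>
  Deleting two different entries of a tuple leaves two tuples that agree, up to order, in all but
  one entry. This is why one round of deletion shrinks the spread of a tuple by the factor \<open>1/n\<close>.
\<close>

lemma delete_entry_common_part:
  assumes "l < length xs" "m < length xs" "xs ! l \<noteq> xs ! m"
  obtains rs where "mset (delete_entry l xs) = mset (xs ! m # rs)"
    and "mset (delete_entry m xs) = mset (xs ! l # rs)"
proof -
  have "xs ! l \<in># mset xs"
    using assms by simp
  then obtain M where M: "mset xs = add_mset (xs ! l) M"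
    by (meson multi_member_split)
  moreover have "xs ! m \<in># mset xs"
    using assms by simp
  ultimately have "xs ! m \<in># M"
    using assms(3) by (metis insert_iff set_mset_add_mset_insert)
  then obtain R where R: "M = add_mset (xs ! m) R"
    by (meson multi_member_split)
  obtain rs where "mset rs = R"
    using ex_mset by blast
  then have "mset (delete_entry l xs) = mset (xs ! m # rs)" "mset (delete_entry m xs) = mset (xs ! l # rs)"
    using assms M R by (simp_all add: mset_delete_entry add_mset_commute)
  with that show thesis by blast
qed

definition iterated_mean :: "nat \<Rightarrow> ('a::topological_space list \<Rightarrow> 'a) \<Rightarrow> 'a list \<Rightarrow> 'a" where
  "iterated_mean n b xs = diagonal_limit (Suc n) (\<lambda>k. (delete_step b ^^ k) xs)"

context
  fixes n :: nat and b :: "'a::complete_space list \<Rightarrow> 'a"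
  assumes mean: "contracting_mean n b" and n: "n \<ge> 2"
begin

lemma dist_delete_step_le:
  assumes "length xs = Suc n" "l < Suc n" "m < Suc n"
  shows "real n * dist (delete_step b xs ! l) (delete_step b xs ! m) \<le> dist (xs ! l) (xs ! m)"
proof (cases "xs ! l = xs ! m")
  case True
  then have "b (delete_entry l xs) = b (delete_entry m xs)"
    using assms by (intro mean_sym[OF mean]) (simp_all add: length_delete_entry mset_delete_entry)
  then show ?thesis
    using assms by (simp add: delete_step_nth)
next
  case False
  then obtain rs where rs: "mset (delete_entry l xs) = mset (xs ! m # rs)"
    "mset (delete_entry m xs) = mset (xs ! l # rs)"
    using delete_entry_common_part[of l xs m] assms by auto
  have len: "length (delete_entry l xs) = n" "length (delete_entry m xs) = n"
    using assms by (simp_all add: length_delete_entry)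
  have "length (xs ! m # rs) = n"
    using len(1) rs(1) by (metis size_mset)
  then have "real n * dist (b (xs ! m # rs)) (b (xs ! l # rs)) \<le> dist (xs ! m) (xs ! l)"
    using mean_dist[OF mean, of "xs ! m # rs" "xs ! l # rs"] by simp
  moreover have "b (delete_entry l xs) = b (xs ! m # rs)" "b (delete_entry m xs) = b (xs ! l # rs)"
    using mean_sym[OF mean, OF len(1) rs(1)] mean_sym[OF mean, OF len(2) rs(2)] by simp_all
  ultimately show ?thesis
    using assms by (simp add: delete_step_nth dist_commute)
qed

lemma dist_delete_step_point_le:
  assumes "length xs = Suc n" "l < Suc n" "\<And>i. i < Suc n \<Longrightarrow> dist (xs ! i) z \<le> r"
  shows "dist (delete_step b xs ! l) z \<le> r"
proof -
  have "dist x z \<le> r" if "x \<in> set (delete_entry l xs)" for x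
    using that set_delete_entry_subset[of l xs] assms by (metis in_set_conv_nth subsetD)
  then have "dist (b (delete_entry l xs)) z \<le> r"
    using assms n by (intro mean_dist_point_le[OF mean]) (auto simp: length_delete_entry)
  then show ?thesis using assms by (simp add: delete_step_nth)
qed

text \<open>
  The spread decays geometrically, and by Jensen's inequality no later entry leaves a ball about
  an earlier entry that contains all entries of that stage. Hence every coordinate is a Cauchy
  sequence and all coordinates share one limit.
\<close>

lemma iterated_delete_step_tendsto:
  assumes xs: "length xs = Suc n"
  obtains p where "\<And>i. i < Suc n \<Longrightarrow> (\<lambda>k. (delete_step b ^^ k) xs ! i) \<longlonglongrightarrow> p"
proof -
  define X where "X = (\<lambda>k. (delete_step b ^^ k) xs)"
  have len: "length (X k) = Suc n" for k
    using xs by (simp add: X_def)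
  have X_Suc: "X (Suc k) = delete_step b (X k)" for k
    by (simp add: X_def)
  define D where "D = (\<Sum>i<Suc n. \<Sum>j<Suc n. dist (xs ! i) (xs ! j))"
  have D: "dist (xs ! i) (xs ! j) \<le> D" if "i < Suc n" "j < Suc n" for i j
  proof -
    have "dist (xs ! i) (xs ! j) \<le> (\<Sum>j<Suc n. dist (xs ! i) (xs ! j))"
      using that by (intro member_le_sum) auto
    also have "\<dots> \<le> D"
      unfolding D_def using that by (intro member_le_sum[of i]) (auto intro!: sum_nonneg simp del: sum.lessThan_Suc)
    finally show ?thesis .
  qed
  have spread: "dist (X k ! i) (X k ! j) \<le> D * (1/2) ^ k" if "i < Suc n" "j < Suc n" for i j k
    using that
  proof (induction k arbitrary: i j)
    case 0
    then show ?case using D by (simp add: X_def)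
  next
    case (Suc k)
    have "2 * dist (X (Suc k) ! i) (X (Suc k) ! j) \<le> real n * dist (X (Suc k) ! i) (X (Suc k) ! j)"
      using n by (intro mult_right_mono) auto
    also have "\<dots> \<le> dist (X k ! i) (X k ! j)"
      unfolding X_Suc using dist_delete_step_le Suc.prems len by blast
    also have "\<dots> \<le> D * (1/2) ^ k"
      using Suc by blast
    finally show ?case by simp
  qed
  have tail: "dist (X (k + m) ! i) (X k ! j) \<le> D * (1/2) ^ k" if "i < Suc n" "j < Suc n" for i j k m
    using that(1)
  proof (induction m arbitrary: i)
    case 0
    then show ?case using spread that by simp
  next
    case (Suc m)
    have "dist (X (Suc (k + m)) ! i) (X k ! j) \<le> D * (1/2) ^ k"
      unfolding X_Suc by (rule dist_delete_step_point_le[OF len Suc.prems]) (rule Suc.IH)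
    then show ?case by simp
  qed
  have small: "(\<lambda>k. D * (1/2) ^ k) \<longlonglongrightarrow> 0"
    by (intro tendsto_mult_right_zero LIMSEQ_power_zero) simp
  have "convergent (\<lambda>k. X k ! 0)"
    by (rule convergent_if_tail_bound[OF _ small, of 0]) (rule tail; simp)
  then obtain p where p: "(\<lambda>k. X k ! 0) \<longlonglongrightarrow> p"
    unfolding convergent_def by blast
  have "(\<lambda>k. X k ! i) \<longlonglongrightarrow> p" if "i < Suc n" for i
  proof -
    have bound: "norm (dist (X k ! i) p) \<le> D * (1/2) ^ k + dist (X k ! 0) p" for k
      using spread[OF that, of 0 k] dist_triangle[of "X k ! i" p "X k ! 0"] by simp
    have "(\<lambda>k. D * (1/2) ^ k + dist (X k ! 0) p) \<longlonglongrightarrow> 0 + 0"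
      using p by (intro tendsto_add small tendsto_dist_iff[THEN iffD1])
    then have "(\<lambda>k. D * (1/2) ^ k + dist (X k ! 0) p) \<longlonglongrightarrow> 0"
      by (simp only: add_0)
    then have "(\<lambda>k. dist (X k ! i) p) \<longlonglongrightarrow> 0"
      by (rule Lim_null_comparison[OF always_eventually[OF allI[OF bound]]])
    then show ?thesis by (rule tendsto_dist_iff[THEN iffD2])
  qed
  with that show thesis unfolding X_def by blast
qed

lemma iterated_mean_tendsto:
  assumes "length xs = Suc n" "i < Suc n"
  shows "(\<lambda>k. (delete_step b ^^ k) xs ! i) \<longlonglongrightarrow> iterated_mean n b xs"
proof -
  obtain p where p: "\<And>i. i < Suc n \<Longrightarrow> (\<lambda>k. (delete_step b ^^ k) xs ! i) \<longlonglongrightarrow> p"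
    using iterated_delete_step_tendsto[OF assms(1)] by blast
  have "iterated_mean n b xs = p"
    unfolding iterated_mean_def diagonal_limit_def
  proof (rule the_equality)
    fix q assume "\<forall>i<Suc n. (\<lambda>k. (delete_step b ^^ k) xs ! i) \<longlonglongrightarrow> q"
    then show "q = p"
      using LIMSEQ_unique[OF _ p[of 0]] by simp
  qed (use p in blast)
  with p assms show ?thesis by simp
qed

lemma iterated_mean_delete_step:
  assumes "length xs = Suc n"
  shows "iterated_mean n b (delete_step b xs) = iterated_mean n b xs"
proof -
  have "(\<lambda>k. (delete_step b ^^ k) (delete_step b xs) ! 0) \<longlonglongrightarrow> iterated_mean n b xs"
    using LIMSEQ_Suc[OF iterated_mean_tendsto[OF assms, of 0]] by (simp add: funpow_swap1)
  moreover have "(\<lambda>k. (delete_step b ^^ k) (delete_step b xs) ! 0) \<longlonglongrightarrow> iterated_mean n b (delete_step b xs)"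
    using assms by (intro iterated_mean_tendsto) auto
  ultimately show ?thesis by (rule LIMSEQ_unique[symmetric])
qed

text \<open>
  Every pair of corresponding entries is counted in all but one of the \<open>n + 1\<close> deletions, and each
  deletion contributes with weight \<open>1/n\<close>.
\<close>

lemma tuple_dist_delete_step_le:
  assumes "length xs = Suc n" "length ys = Suc n"
  shows "tuple_dist (delete_step b xs) (delete_step b ys) \<le> tuple_dist xs ys"
proof -
  let ?d = "\<lambda>l. dist (xs ! l) (ys ! l)"
  have "real n * tuple_dist (delete_step b xs) (delete_step b ys)
    = (\<Sum>l<Suc n. real n * dist (b (delete_entry l xs)) (b (delete_entry l ys)))"
    using assms by (simp add: tuple_dist_conv_sum[where n = "Suc n"] delete_step_nth sum_distrib_left
        del: sum.lessThan_Suc)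
  also have "\<dots> \<le> (\<Sum>l<Suc n. tuple_dist xs ys - ?d l)"
  proof (rule sum_mono)
    fix l assume "l \<in> {..<Suc n}"
    then show "real n * dist (b (delete_entry l xs)) (b (delete_entry l ys)) \<le> tuple_dist xs ys - ?d l"
      using mean_dist[OF mean, of "delete_entry l xs" "delete_entry l ys"] assms
      by (simp add: length_delete_entry tuple_dist_delete_entry)
  qed
  also have "\<dots> = real n * tuple_dist xs ys"
    using tuple_dist_conv_sum[OF assms] by (simp add: sum_subtractf algebra_simps)
  finally show ?thesis using n by simp
qed

text \<open>
  The new entries are values of \<open>b\<close> on sub-multisets, so as a multiset they are a function of the
  multiset of the old ones.
\<close>

lemma mset_delete_step:
  assumes "length xs = Suc n" "mset xs = mset ys"
  shows "mset (delete_step b xs) = mset (delete_step b ys)"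
proof -
  \<comment> \<open>A symmetric function of tuples, regarded as a function of multisets.\<close>
  define B where "B = (\<lambda>M. b (SOME zs. mset zs = M))"
  have B: "b zs = B (mset zs)" if "length zs = n" for zs
  proof -
    have "mset (SOME zs'. mset zs' = mset zs) = mset zs"
      by (rule someI[of _ zs]) (rule refl)
    then show ?thesis
      unfolding B_def using mean_sym[OF mean that] by metis
  qed
  have "mset (delete_step b zs) = image_mset (\<lambda>a. B (mset zs - {#a#})) (mset zs)" if "length zs = Suc n" for zs
  proof -
    have "delete_step b zs = map (\<lambda>a. B (mset zs - {#a#})) zs"
      using that by (intro nth_equalityI) (auto simp: delete_step_nth B length_delete_entry mset_delete_entry)
    then show ?thesis by simp
  qed
  with assms show ?thesis by (metis size_mset)
qed

text \<open>
  Symmetry needs more than symmetry of the delete step, since reordering the tuple moves the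
  coordinates around: it is used that all coordinates converge to the same limit.
\<close>

lemma contracting_mean_iterated: "contracting_mean (Suc n) (iterated_mean n b)"
  unfolding contracting_mean_def
proof (intro conjI allI impI)
  fix xs ys :: "'a list"
  assume *: "length xs = Suc n \<and> mset xs = mset ys"
  then have ys: "length ys = Suc n" by (metis size_mset)
  let ?X = "\<lambda>k. (delete_step b ^^ k) xs" and ?Y = "\<lambda>k. (delete_step b ^^ k) ys"
  have "mset (?X k) = mset (?Y k)" for k
  proof (induction k)
    case (Suc k)
    then show ?case using mset_delete_step[of "?X k" "?Y k"] * by simp
  qed (use * in simp)
  moreover have "(delete_step b ^^ k) xs ! 0 \<in> set ((delete_step b ^^ k) xs)" for k
    using * by (intro nth_mem) simp
  ultimately have "(delete_step b ^^ k) xs ! 0 \<in> set ((delete_step b ^^ k) ys)" for k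
    by (metis mset_eq_setD)
  then have "\<exists>i<Suc n. (delete_step b ^^ k) xs ! 0 = (delete_step b ^^ k) ys ! i" for k
    using ys by (metis in_set_conv_nth length_delete_step_funpow)
  \<comment> \<open>The position \<open>i k\<close> may vary with \<open>k\<close>, so the bound sums over all positions.\<close>
  then obtain i where i: "\<And>k. i k < Suc n" "\<And>k. (delete_step b ^^ k) xs ! 0 = (delete_step b ^^ k) ys ! i k"
    by metis
  have "(\<lambda>k. \<Sum>j<Suc n. dist ((delete_step b ^^ k) ys ! j) (iterated_mean n b ys)) \<longlonglongrightarrow> (\<Sum>j<Suc n. 0)"
    using iterated_mean_tendsto[OF ys] by (intro tendsto_sum tendsto_dist_iff[THEN iffD1]) auto
  then have "(\<lambda>k. \<Sum>j<Suc n. dist ((delete_step b ^^ k) ys ! j) (iterated_mean n b ys)) \<longlonglongrightarrow> 0"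
    by simp
  then have "(\<lambda>k. dist ((delete_step b ^^ k) xs ! 0) (iterated_mean n b ys)) \<longlonglongrightarrow> 0"
    by (rule Lim_null_comparison[rotated])
      (use i in \<open>auto intro!: always_eventually member_le_sum simp del: sum.lessThan_Suc\<close>)
  then have "(\<lambda>k. (delete_step b ^^ k) xs ! 0) \<longlonglongrightarrow> iterated_mean n b ys"
    by (rule tendsto_dist_iff[THEN iffD2])
  then show "iterated_mean n b xs = iterated_mean n b ys"
    using LIMSEQ_unique[OF iterated_mean_tendsto[of xs 0]] * by simp
next
  fix xs ys :: "'a list"
  assume *: "length xs = Suc n \<and> length ys = Suc n"
  let ?X = "\<lambda>k. (delete_step b ^^ k) xs" and ?Y = "\<lambda>k. (delete_step b ^^ k) ys"
  have "tuple_dist (?X k) (?Y k) \<le> tuple_dist xs ys" for k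
  proof (induction k)
    case (Suc k)
    then show ?case using tuple_dist_delete_step_le[of "?X k" "?Y k"] * by simp
  qed simp
  then have "\<forall>k. (\<Sum>i<Suc n. dist (?X k ! i) (?Y k ! i)) \<le> tuple_dist xs ys"
    using * by (simp add: tuple_dist_conv_sum[where n = "Suc n"] del: sum.lessThan_Suc)
  moreover have "(\<lambda>k. \<Sum>i<Suc n. dist (?X k ! i) (?Y k ! i))
      \<longlonglongrightarrow> (\<Sum>i<Suc n. dist (iterated_mean n b xs) (iterated_mean n b ys))"
    using * by (intro tendsto_sum tendsto_dist iterated_mean_tendsto) auto
  ultimately have "(\<Sum>i<Suc n. dist (iterated_mean n b xs) (iterated_mean n b ys)) \<le> tuple_dist xs ys"
    by (intro LIMSEQ_le_const2) auto
  then show "real (Suc n) * dist (iterated_mean n b xs) (iterated_mean n b ys) \<le> tuple_dist xs ys"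
    by simp
next
  fix x
  have "delete_step b (replicate (Suc n) x) = replicate (Suc n) x"
    by (intro nth_equalityI)
      (auto simp: delete_step_nth delete_entry_replicate mean_replicate[OF mean] simp del: replicate_Suc)
  then have "(delete_step b ^^ k) (replicate (Suc n) x) = replicate (Suc n) x" for k
    by (induction k) auto
  then show "iterated_mean n b (replicate (Suc n) x) = x"
    using iterated_mean_tendsto[of "replicate (Suc n) x" 0] by (simp add: LIMSEQ_const_iff)
qed

text \<open>
  Jensen's inequality applied after one delete step, which does not move the limit.
\<close>

lemma iterated_mean_dist_point:
  assumes "length xs = Suc n"
  shows "real (Suc n) * dist (iterated_mean n b xs) z \<le> (\<Sum>l<Suc n. dist (b (delete_entry l xs)) z)"
proof -
  have "real (Suc n) * dist (iterated_mean n b (delete_step b xs)) z \<le> (\<Sum>x\<leftarrow>delete_step b xs. dist x z)"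
    using assms by (intro mean_dist_point[OF contracting_mean_iterated]) simp
  then show ?thesis
    using assms by (simp add: iterated_mean_delete_step sum_list_map_conv_sum delete_step_nth
        del: sum.lessThan_Suc)
qed

end

section \<open>The maps built from a bicombing\<close>

lemma contracting_mean_1: "contracting_mean (Suc 0) (bmap \<sigma> (Suc 0))"
  by (auto simp: contracting_mean_def length_Suc_conv)

lemma bmap_Suc:
  assumes "n \<ge> 2"
  shows "bmap \<sigma> (Suc n) = iterated_mean n (bmap \<sigma> n)"
proof -
  obtain m where "n = Suc (Suc m)"
    using assms by (metis add_2_eq_Suc le_Suc_ex)
  then show ?thesis by (simp add: iterated_mean_def fun_eq_iff)
qed

lemma bmap_2: "bmap \<sigma> 2 [x, y] = \<sigma> x y (1/2)"
  by (simp add: numeral_2_eq_2)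

lemma bmap_induct [consumes 1, case_names 1 2 Suc]:
  assumes "n \<ge> 1" "P 1" "P 2" "\<And>n. n \<ge> 2 \<Longrightarrow> P n \<Longrightarrow> P (Suc n)"
  shows "P n"
proof (cases "n = 1")
  case False
  with assms(1) have "n \<ge> 2" by simp
  then show ?thesis
    by (induction n rule: nat_induct_at_least) (use assms in auto)
qed (use assms in simp)

locale midpoint_bicombing =
  fixes \<sigma> :: "'a::complete_space \<Rightarrow> 'a \<Rightarrow> real \<Rightarrow> 'a"
  assumes bicombing: "conical_geodesic_bicombing \<sigma>" and midpoint: "midpoint_property \<sigma>"
begin

lemma contracting_mean_2: "contracting_mean 2 (bmap \<sigma> 2)"
proof -
  have b2: "bmap \<sigma> 2 = (\<lambda>xs. \<sigma> (xs ! 0) (xs ! 1) (1/2))"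
    by (simp add: numeral_2_eq_2)
  have conv: "\<forall>x y x' y'. \<forall>t\<in>{0..1}. dist (\<sigma> x y t) (\<sigma> x' y' t) \<le> (1 - t) * dist x x' + t * dist y y'"
    using bicombing unfolding conical_geodesic_bicombing_def by blast
  have conical: "dist (\<sigma> x y (1/2)) (\<sigma> x' y' (1/2)) \<le> 1/2 * dist x x' + 1/2 * dist y y'" for x y x' y'
    using bspec[OF spec[OF spec[OF spec[OF spec[OF conv, of x], of y], of x'], of y'], of "1/2"] by simp
  have idem: "\<sigma> x x (1/2) = x" for x
  proof -
    have "\<forall>s\<in>{0..1}. \<forall>t\<in>{0..1}. dist (\<sigma> x x s) (\<sigma> x x t) = \<bar>s - t\<bar> * dist x x"
      and "\<sigma> x x 0 = x"
      using bicombing unfolding conical_geodesic_bicombing_def by blast+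
    from bspec[OF bspec[OF this(1), of "1/2"], of 0] this(2) show ?thesis by simp
  qed
  have sym: "\<sigma> x y (1/2) = \<sigma> y x (1/2)" for x y
    using midpoint unfolding midpoint_property_def by blast
  show ?thesis
    unfolding contracting_mean_def
  proof (intro conjI allI impI)
    fix xs ys :: "'a list"
    assume *: "length xs = 2 \<and> mset xs = mset ys"
    then have "length xs = 2" "length ys = 2"
      using mset_eq_length[of xs ys] by simp_all
    then obtain x y x' y' where "xs = [x, y]" "ys = [x', y']"
      by (auto simp: numeral_2_eq_2 length_Suc_conv)
    with * show "bmap \<sigma> 2 xs = bmap \<sigma> 2 ys"
      using sym by (auto simp: b2 add_eq_conv_ex)
  next
    fix xs ys :: "'a list"
    assume "length xs = 2 \<and> length ys = 2"
    then obtain x y x' y' where "xs = [x, y]" "ys = [x', y']"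
      by (auto simp: numeral_2_eq_2 length_Suc_conv)
    then show "real 2 * dist (bmap \<sigma> 2 xs) (bmap \<sigma> 2 ys) \<le> tuple_dist xs ys"
      using conical[of x y x' y'] by (simp add: b2)
  next
    fix x
    show "bmap \<sigma> 2 (replicate 2 x) = x"
      by (simp add: b2 idem numeral_2_eq_2)
  qed
qed

lemma contracting_mean_bmap: "n \<ge> 1 \<Longrightarrow> contracting_mean n (bmap \<sigma> n)"
proof (induction n rule: nat_induct_at_least)
  case base
  then show ?case using contracting_mean_1 by simp
next
  case (Suc n)
  show ?case
  proof (cases "n \<ge> 2")
    case True
    then show ?thesis
      using contracting_mean_iterated[OF Suc.IH] by (simp only: bmap_Suc)
  next
    case False
    with Suc.hyps have "Suc n = 2" by simp
    then show ?thesis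
      using contracting_mean_2 by (simp only:)
  qed
qed

lemma bmap_dist_point:
  assumes "length xs = Suc n" "n \<ge> 2"
  shows "real (Suc n) * dist (bmap \<sigma> (Suc n) xs) z \<le> (\<Sum>l<Suc n. dist (bmap \<sigma> n (delete_entry l xs)) z)"
  using iterated_mean_dist_point[OF contracting_mean_bmap assms(2,1)] assms(2) by (simp only: bmap_Suc)

lemma bmap_tendsto:
  assumes "length xs = Suc n" "n \<ge> 2" "i < Suc n"
  shows "(\<lambda>k. (delete_step (bmap \<sigma> n) ^^ k) xs ! i) \<longlonglongrightarrow> bmap \<sigma> (Suc n) xs"
  using iterated_mean_tendsto[OF contracting_mean_bmap assms(2,1,3)] assms(2) by (simp only: bmap_Suc)

lemma bmap_in_closed:
  assumes C: "closed C" "\<And>x y. x \<in> C \<Longrightarrow> y \<in> C \<Longrightarrow> \<sigma> x y (1/2) \<in> C"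
    and "n \<ge> 1" "length xs = n" "set xs \<subseteq> C"
  shows "bmap \<sigma> n xs \<in> C"
  using assms(3-)
proof (induction n arbitrary: xs rule: bmap_induct)
  case 1
  then show ?case by (auto simp: length_Suc_conv)
next
  case 2
  then show ?case using C(2) by (auto simp: length_Suc_conv numeral_2_eq_2)
next
  case (Suc n)
  have "set ((delete_step (bmap \<sigma> n) ^^ k) xs) \<subseteq> C" for k
  proof (induction k)
    case (Suc k)
    let ?X = "(delete_step (bmap \<sigma> n) ^^ k) xs"
    have "bmap \<sigma> n (delete_entry l ?X) \<in> C" if "l < length xs" for l
      using that Suc.IH set_delete_entry_subset[of l ?X] \<open>length xs = Suc n\<close>
      by (intro \<open>\<And>xs. length xs = n \<Longrightarrow> set xs \<subseteq> C \<Longrightarrow> bmap \<sigma> n xs \<in> C\<close>)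
        (auto simp: length_delete_entry)
    then show ?case
      by (auto simp: in_set_conv_nth delete_step_nth)
  qed (use Suc.prems in simp)
  moreover have "(delete_step (bmap \<sigma> n) ^^ k) xs ! 0 \<in> set ((delete_step (bmap \<sigma> n) ^^ k) xs)" for k
    using Suc.prems by (intro nth_mem) simp
  ultimately have "(delete_step (bmap \<sigma> n) ^^ k) xs ! 0 \<in> C" for k by blast
  then show ?case
    by (rule closed_sequentially[OF C(1) _ bmap_tendsto[OF Suc.prems(1) Suc.hyps(1) zero_less_Suc]])
qed

lemma bmap_equivariant:
  assumes \<phi>: "continuous_on UNIV \<phi>" "\<And>x y. \<phi> (\<sigma> x y (1/2)) = \<sigma> (\<phi> x) (\<phi> y) (1/2)"
    and "n \<ge> 1" "length xs = n"
  shows "\<phi> (bmap \<sigma> n xs) = bmap \<sigma> n (map \<phi> xs)"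
  using assms(3-)
proof (induction n arbitrary: xs rule: bmap_induct)
  case 1
  then show ?case by (auto simp: length_Suc_conv)
next
  case 2
  then show ?case using \<phi>(2) by (auto simp: length_Suc_conv numeral_2_eq_2)
next
  case (Suc n)
  let ?d = "delete_step (bmap \<sigma> n)"
  have map_d: "map \<phi> (?d zs) = ?d (map \<phi> zs)" if "length zs = Suc n" for zs
    using that Suc.IH by (intro nth_equalityI) (auto simp: delete_step_nth length_delete_entry map_delete_entry)
  have map_dk: "map \<phi> ((?d ^^ k) xs) = (?d ^^ k) (map \<phi> xs)" for k
    using Suc.prems by (induction k) (auto simp: map_d)
  have "(\<lambda>k. \<phi> ((?d ^^ k) xs ! 0)) \<longlonglongrightarrow> \<phi> (bmap \<sigma> (Suc n) xs)"
    using \<phi>(1) bmap_tendsto[OF Suc.prems(1) Suc.hyps(1), of 0]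
    by (intro isCont_tendsto_compose[where g = \<phi>]) (auto simp: continuous_on_eq_continuous_at)
  moreover have "\<phi> ((?d ^^ k) xs ! 0) = (?d ^^ k) (map \<phi> xs) ! 0" for k
    using Suc.prems by (simp flip: map_dk)
  ultimately have "(\<lambda>k. (?d ^^ k) (map \<phi> xs) ! 0) \<longlonglongrightarrow> \<phi> (bmap \<sigma> (Suc n) xs)"
    by (simp only:)
  moreover have "(\<lambda>k. (?d ^^ k) (map \<phi> xs) ! 0) \<longlonglongrightarrow> bmap \<sigma> (Suc n) (map \<phi> xs)"
    using Suc.prems Suc.hyps by (intro bmap_tendsto) auto
  ultimately show ?case by (rule LIMSEQ_unique)
qed

end

section \<open>Means of randomly thinned tuples\<close>

text \<open>
  Frequencies are compared in the squared Euclidean distance because its mean over random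
  deletions can be computed exactly.
\<close>

definition freq_deviation :: "'a set \<Rightarrow> ('a \<Rightarrow> real) \<Rightarrow> 'a multiset \<Rightarrow> real" where
  "freq_deviation A p M = (\<Sum>a\<in>A. (real (count M a) / real (size M) - p a)\<^sup>2)"

lemma sum_of_bool_eq_count: "(\<Sum>l<length xs. of_bool (xs ! l = a)) = real (count (mset xs) a)"
proof -
  have "(\<Sum>x\<leftarrow>xs. of_bool (x = a)) = real (count (mset xs) a)"
    by (induction xs) auto
  then show ?thesis by (simp add: sum_list_map_conv_sum)
qed

lemma sum_count_eq_size:
  assumes "finite A" "set_mset M \<subseteq> A"
  shows "(\<Sum>a\<in>A. count M a) = size M"
  unfolding size_multiset_overloaded_eq using assms
  by (intro sum.mono_neutral_right) (auto simp: count_eq_zero_iff)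

text \<open>
  Deleting a random entry leaves the expected frequencies unchanged and adds a variance of
  \<open>t (1 - t) / n\<^sup>2\<close> for a point of frequency \<open>t\<close>. These variances sum up to at most \<open>1/n\<^sup>2\<close> because the
  frequencies sum up to \<open>1\<close>.
\<close>

lemma sum_freq_deviation_delete_entry_le:
  assumes A: "finite A" "set xs \<subseteq> A" and len: "length xs = Suc n" and n: "n \<ge> 1"
  shows "(\<Sum>l<Suc n. freq_deviation A p (mset (delete_entry l xs)))
    \<le> real (Suc n) * (freq_deviation A p (mset xs) + 1 / (real n)\<^sup>2)"
proof -
  define N where "N = real n"
  have N: "N \<ge> 1" "real (Suc n) = N + 1" using n by (simp_all add: N_def)
  have point: "(\<Sum>l<Suc n. (real (count (mset (delete_entry l xs)) a) / N - p a)\<^sup>2)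
    \<le> (N + 1) * (real (count (mset xs) a) / (N + 1) - p a)\<^sup>2 + real (count (mset xs) a) / N\<^sup>2" for a
  proof -
    define c where "c = real (count (mset xs) a)"
    define t where "t = c / (N + 1)"
    have "c = t * (N + 1)" using N(1) by (simp add: t_def)
    then have c: "c = t * N + t" by (simp add: distrib_left)
    have "(\<Sum>l<Suc n. (real (count (mset (delete_entry l xs)) a) / N - p a)\<^sup>2)
      = (\<Sum>l<Suc n. (c / N - p a)\<^sup>2 - (2 * (c / N - p a) / N - 1 / N\<^sup>2) * of_bool (xs ! l = a))"
    proof (rule sum.cong[OF refl])
      fix l assume "l \<in> {..<Suc n}"
      then have l: "l < length xs" using len by simp
      have "real (count (mset (delete_entry l xs)) a) = c - of_bool (xs ! l = a)"
        using l by (auto simp: mset_delete_entry c_def of_nat_diff Suc_le_eq count_greater_zero_iff)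
      then show "(real (count (mset (delete_entry l xs)) a) / N - p a)\<^sup>2
        = (c / N - p a)\<^sup>2 - (2 * (c / N - p a) / N - 1 / N\<^sup>2) * of_bool (xs ! l = a)"
        using N by (auto simp: power2_eq_square field_simps)
    qed
    also have "\<dots> = (N + 1) * (c / N - p a)\<^sup>2 - (2 * (c / N - p a) / N - 1 / N\<^sup>2) * c"
      using sum_of_bool_eq_count[of xs a] len N(2)
      by (simp add: sum_subtractf sum_distrib_left[symmetric] c_def del: sum.lessThan_Suc)
    also have "\<dots> = (N + 1) * ((t - p a)\<^sup>2 + (t - t\<^sup>2) / N\<^sup>2)"
      unfolding c using N by (simp add: power2_eq_square field_simps)
    also have "\<dots> \<le> (N + 1) * ((t - p a)\<^sup>2 + t / N\<^sup>2)"
      using N by (intro mult_left_mono add_left_mono divide_right_mono) auto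
    also have "\<dots> = (N + 1) * (t - p a)\<^sup>2 + c / N\<^sup>2"
      unfolding c by (simp add: field_simps)
    finally show ?thesis unfolding t_def c_def .
  qed
  have "(\<Sum>l<Suc n. freq_deviation A p (mset (delete_entry l xs)))
    = (\<Sum>l<Suc n. \<Sum>a\<in>A. (real (count (mset (delete_entry l xs)) a) / N - p a)\<^sup>2)"
    using len by (intro sum.cong) (auto simp: freq_deviation_def length_delete_entry N_def)
  also have "\<dots> = (\<Sum>a\<in>A. \<Sum>l<Suc n. (real (count (mset (delete_entry l xs)) a) / N - p a)\<^sup>2)"
    by (rule sum.swap)
  also have "\<dots> \<le> (\<Sum>a\<in>A. (N + 1) * (real (count (mset xs) a) / (N + 1) - p a)\<^sup>2 + real (count (mset xs) a) / N\<^sup>2)"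
    by (intro sum_mono point)
  also have "\<dots> = (N + 1) * freq_deviation A p (mset xs) + (\<Sum>a\<in>A. real (count (mset xs) a)) / N\<^sup>2"
    using len N(2) by (simp add: freq_deviation_def sum.distrib sum_distrib_left sum_divide_distrib
        add.commute[of 1 N])
  also have "(\<Sum>a\<in>A. real (count (mset xs) a)) = N + 1"
    using sum_count_eq_size[of A "mset xs"] A len N(2) by (simp flip: of_nat_sum)
  finally show ?thesis
    using N by (simp add: N_def algebra_simps del: sum.lessThan_Suc)
qed

lemma size_diff_mset_le:
  assumes "finite A" "set_mset M \<subseteq> A"
  shows "real (size (M - M')) \<le> (\<Sum>a\<in>A. \<bar>real (count M a) - real (count M' a)\<bar>)"
proof -
  have "set_mset (M - M') \<subseteq> A"
    using assms(2) in_diffD by fastforce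
  then have "real (size (M - M')) = (\<Sum>a\<in>A. real (count (M - M') a))"
    using sum_count_eq_size[OF assms(1), of "M - M'"] by (metis of_nat_sum)
  also have "\<dots> \<le> (\<Sum>a\<in>A. \<bar>real (count M a) - real (count M' a)\<bar>)"
    by (intro sum_mono) auto
  finally show ?thesis .
qed

lemma tuple_dist_le_length:
  assumes "\<And>x y. x \<in> set xs \<Longrightarrow> y \<in> set ys \<Longrightarrow> dist x y \<le> D" "length xs = length ys"
  shows "tuple_dist xs ys \<le> D * real (length xs)"
  using assms(2,1)
proof (induction xs ys rule: list_induct2)
  case (Cons x xs y ys)
  then have "dist x y \<le> D" "tuple_dist xs ys \<le> D * real (length xs)"
    by auto
  then show ?case by (simp add: distrib_left)
qed simp

text \<open>
  Reorder both tuples so that their common part is aligned; then only the remaining entries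
  contribute to the distance.
\<close>

lemma mean_dist_mset_le:
  assumes mean: "contracting_mean n b" and len: "length xs = n" "length ys = n"
    and D: "\<And>x y. x \<in> set xs \<Longrightarrow> y \<in> set ys \<Longrightarrow> dist x y \<le> D"
  shows "real n * dist (b xs) (b ys) \<le> D * real (size (mset xs - mset ys))"
proof -
  obtain zs rs ss where ex: "mset zs = mset xs \<inter># mset ys" "mset rs = mset xs - mset ys"
    "mset ss = mset ys - mset xs"
    using ex_mset by metis
  have xs: "mset (zs @ rs) = mset xs" and ys: "mset (zs @ ss) = mset ys"
    using ex by (auto simp: multiset_eq_iff)
  then have lens: "length (zs @ rs) = n" "length (zs @ ss) = n" "length rs = length ss"
    using len by (metis size_mset, metis size_mset, metis size_mset length_append add_left_cancel)
  have sub: "set rs \<subseteq> set xs" "set ss \<subseteq> set ys"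
    using xs ys by (metis mset_eq_setD set_append sup_ge2)+
  have "real n * dist (b (zs @ rs)) (b (zs @ ss)) \<le> tuple_dist (zs @ rs) (zs @ ss)"
    using mean lens unfolding contracting_mean_def by blast
  also have "\<dots> = tuple_dist rs ss"
    by (simp add: tuple_dist_append)
  also have "\<dots> \<le> D * real (length rs)"
    using sub lens(3) D by (intro tuple_dist_le_length) auto
  also have "length rs = size (mset xs - mset ys)"
    using ex(2) by (metis size_mset)
  finally show ?thesis
    using mean lens xs ys unfolding contracting_mean_def by metis
qed

text \<open>
  Bounding \<open>\<bar>u\<bar>\<close> in terms of \<open>u\<^sup>2\<close> makes the distance estimate affine in the deviation, the quantity
  whose mean over random deletions is under control.
\<close>

lemma abs_le_square_bound:
  fixes u \<epsilon> :: real
  assumes "\<epsilon> > 0"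
  shows "\<bar>u\<bar> \<le> u\<^sup>2 / (2 * \<epsilon>) + \<epsilon> / 2"
proof -
  have "0 \<le> (\<bar>u\<bar> - \<epsilon>)\<^sup>2" by simp
  then have "2 * \<epsilon> * \<bar>u\<bar> \<le> u\<^sup>2 + \<epsilon>\<^sup>2"
    by (simp add: power2_diff algebra_simps)
  then show ?thesis
    using assms by (simp add: field_simps power2_eq_square)
qed

lemma mean_dist_freq_le:
  assumes mean: "contracting_mean n b" and len: "length xs = n" "length ys = n" and n: "n \<ge> 1"
    and A: "finite A" "set xs \<subseteq> A" "set ys \<subseteq> A" and D: "\<And>x y. x \<in> A \<Longrightarrow> y \<in> A \<Longrightarrow> dist x y \<le> D" "0 \<le> D"
    and ys: "\<And>a. a \<in> A \<Longrightarrow> real (count (mset ys) a) = real n * p a"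
    and \<epsilon>: "\<epsilon> > 0"
  shows "dist (b xs) (b ys) \<le> D * (freq_deviation A p (mset xs) / (2 * \<epsilon>) + real (card A) * \<epsilon> / 2)"
proof -
  have "real n * dist (b xs) (b ys) \<le> D * real (size (mset xs - mset ys))"
    using A D by (intro mean_dist_mset_le[OF mean len]) auto
  also have "\<dots> \<le> D * (\<Sum>a\<in>A. \<bar>real (count (mset xs) a) - real (count (mset ys) a)\<bar>)"
    using A D by (intro mult_left_mono size_diff_mset_le) auto
  also have "\<dots> = D * (\<Sum>a\<in>A. real n * \<bar>real (count (mset xs) a) / real n - p a\<bar>)"
    using n by (intro arg_cong2[where f = "(*)"] sum.cong refl) (simp add: ys abs_mult_pos' right_diff_distrib)
  also have "\<dots> \<le> D * (\<Sum>a\<in>A. real n * ((real (count (mset xs) a) / real n - p a)\<^sup>2 / (2 * \<epsilon>) + \<epsilon> / 2))"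
    using D \<epsilon> by (intro mult_left_mono sum_mono abs_le_square_bound) auto
  also have "\<dots> = real n * (D * (freq_deviation A p (mset xs) / (2 * \<epsilon>) + real (card A) * \<epsilon> / 2))"
    using len by (simp add: freq_deviation_def sum.distrib sum_distrib_left[symmetric]
        sum_divide_distrib[symmetric])
  finally show ?thesis using n by simp
qed

lemma length_Qrep [simp]: "length (Qrep k xs) = k * length xs"
  by (induction k) (auto simp: Qrep_def)

lemma Qrep_simps [simp]: "Qrep 0 xs = []" "Qrep (Suc k) xs = xs @ Qrep k xs"
  by (simp_all add: Qrep_def)

lemma Qrep_add: "Qrep (k + l) xs = Qrep k xs @ Qrep l xs"
  by (induction k) auto

lemma Qrep_Qrep: "Qrep k (Qrep l xs) = Qrep (k * l) xs"
  by (induction k) (auto simp: Qrep_add)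

lemma set_Qrep_subset: "set (Qrep k xs) \<subseteq> set xs"
  by (induction k) auto

lemma count_mset_Qrep: "count (mset (Qrep k xs)) a = k * count (mset xs) a"
  by (induction k) auto

lemma map_Qrep: "map f (Qrep k xs) = Qrep k (map f xs)"
  by (induction k) auto

lemma tuple_dist_Qrep:
  "length xs = length ys \<Longrightarrow> tuple_dist (Qrep k xs) (Qrep k ys) = real k * tuple_dist xs ys"
  by (induction k) (auto simp: tuple_dist_append algebra_simps)

context midpoint_bicombing
begin

text \<open>
  Induction on the number of deletions. The telescoping term comes from
  \<open>1/N\<^sup>2 \<le> 1/(N - 1) - 1/N\<close>.
\<close>

lemma bmap_dist_thinning_le:
  assumes A: "finite A" and m: "m \<ge> 2" and C: "C \<ge> 0"
    and bound: "\<And>ys. length ys = m \<Longrightarrow> set ys \<subseteq> A \<Longrightarrow>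
      dist (bmap \<sigma> m ys) z \<le> C * freq_deviation A p (mset ys) + B"
    and "N \<ge> m" "length xs = N" "set xs \<subseteq> A"
  shows "dist (bmap \<sigma> N xs) z
    \<le> C * (freq_deviation A p (mset xs) + 1 / real (m - 1) - 1 / real (N - 1)) + B"
  using assms(5-)
proof (induction N arbitrary: xs rule: dec_induct)
  case base
  then show ?case using bound by simp
next
  case (step N)
  let ?V = "\<lambda>xs. freq_deviation A p (mset xs)"
  define E where "E = 1 / real (m - 1)"
  have N: "N \<ge> 2" using step.hyps m by simp
  have "real (Suc N) * dist (bmap \<sigma> (Suc N) xs) z \<le> (\<Sum>l<Suc N. dist (bmap \<sigma> N (delete_entry l xs)) z)"
    using step.prems N by (intro bmap_dist_point)
  also have "\<dots> \<le> (\<Sum>l<Suc N. C * (?V (delete_entry l xs) + E - 1 / real (N - 1)) + B)"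
    unfolding E_def using step.prems set_delete_entry_subset[of _ xs]
    by (intro sum_mono step.IH) (auto simp: length_delete_entry)
  also have "\<dots> = C * (\<Sum>l<Suc N. ?V (delete_entry l xs)) + real (Suc N) * (C * (E - 1 / real (N - 1)) + B)"
    by (simp add: sum.distrib sum_subtractf sum_distrib_left[symmetric] algebra_simps del: sum.lessThan_Suc)
  also have "\<dots> \<le> C * (real (Suc N) * (?V xs + 1 / (real N)\<^sup>2)) + real (Suc N) * (C * (E - 1 / real (N - 1)) + B)"
    using step.prems A C N by (intro add_right_mono mult_left_mono sum_freq_deviation_delete_entry_le) auto
  also have "\<dots> = real (Suc N) * (C * (?V xs + E + (1 / (real N)\<^sup>2 - 1 / real (N - 1))) + B)"
    by (simp add: algebra_simps)
  also have "\<dots> \<le> real (Suc N) * (C * (?V xs + E + - 1 / real N) + B)"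
  proof -
    have "1 / (real N)\<^sup>2 - 1 / real (N - 1) \<le> - 1 / real N"
      using N by (simp add: of_nat_diff power2_eq_square field_simps)
    then show ?thesis
      using C by (intro mult_left_mono add_right_mono add_left_mono) auto
  qed
  finally have "dist (bmap \<sigma> (Suc N) xs) z \<le> C * (?V xs + E + - 1 / real N) + B"
    by simp
  then show ?case by (simp add: E_def)
qed

text \<open>
  Thin out \<open>K\<close> copies of the tuple to its length times \<open>k\<close> and compare with \<open>k\<close> copies. The frequencies
  in \<open>K\<close> copies are exact, so the expected deviation after thinning is of order \<open>1/k\<close>.
\<close>

lemma bseq_dist_le:
  assumes xs: "xs \<noteq> []" and k: "k \<ge> 2" "K \<ge> k"
    and D: "\<And>x y. x \<in> set xs \<Longrightarrow> y \<in> set xs \<Longrightarrow> dist x y \<le> D" "0 \<le> D"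
  shows "dist (bseq \<sigma> xs K) (bseq \<sigma> xs k) \<le> D * (1 + real (card (set xs))) / 2 / sqrt (real k - 1)"
proof -
  let ?A = "set xs"
  let ?L = "length xs"
  let ?m = "?L * k"
  define p where "p = (\<lambda>a. real (count (mset xs) a) / real ?L)"
  \<comment> \<open>This choice balances the two terms \<open>1 / (\<epsilon> (k - 1))\<close> and \<open>\<epsilon>\<close> of the bound.\<close>
  define \<epsilon> where "\<epsilon> = 1 / sqrt (real k - 1)"
  define C where "C = D / (2 * \<epsilon>)"
  define B where "B = D * (real (card ?A) * \<epsilon> / 2)"
  have L: "?L \<ge> 1" using xs by (simp add: Suc_le_eq)
  then have m: "?m \<ge> k" by simp
  then have m2: "?m \<ge> 2" using k by linarith
  have \<epsilon>: "\<epsilon> > 0" using k by (simp add: \<epsilon>_def)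
  have C: "C \<ge> 0" using D \<epsilon> by (simp add: C_def)
  have freq: "real (count (mset (Qrep j xs)) a) = real (?L * j) * p a" for j a
    using L by (simp add: count_mset_Qrep p_def)
  have dev: "freq_deviation ?A p (mset (Qrep K xs)) = 0"
  proof -
    have "size (mset (Qrep K xs)) = ?L * K" by simp
    moreover have "?L * K \<noteq> 0" using xs k by simp
    ultimately show ?thesis
      unfolding freq_deviation_def freq by simp
  qed
  have "dist (bmap \<sigma> ?m ys) (bseq \<sigma> xs k) \<le> C * freq_deviation ?A p (mset ys) + B"
    if "length ys = ?m" "set ys \<subseteq> ?A" for ys
  proof -
    have "dist (bmap \<sigma> ?m ys) (bmap \<sigma> ?m (Qrep k xs))
      \<le> D * (freq_deviation ?A p (mset ys) / (2 * \<epsilon>) + real (card ?A) * \<epsilon> / 2)"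
      using m k that D \<epsilon> set_Qrep_subset[of k xs] freq[of k]
      by (intro mean_dist_freq_le[OF contracting_mean_bmap]) auto
    then show ?thesis
      by (simp add: bseq_def C_def B_def distrib_left)
  qed
  then have "dist (bmap \<sigma> (?L * K) (Qrep K xs)) (bseq \<sigma> xs k)
    \<le> C * (freq_deviation ?A p (mset (Qrep K xs)) + 1 / real (?m - 1) - 1 / real (?L * K - 1)) + B"
    using k C set_Qrep_subset[of K xs] by (intro bmap_dist_thinning_le m2) auto
  also have "\<dots> \<le> C * (1 / (real k - 1)) + B"
  proof -
    have "1 / real (?m - 1) \<le> 1 / real (k - 1)"
    proof (rule frac_le)
      show "real (k - 1) \<le> real (?m - 1)" using m by linarith
    qed (use k in auto)
    then have "1 / real (?m - 1) - 1 / real (?L * K - 1) \<le> 1 / real (k - 1)"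
      by (smt (verit) of_nat_0_le_iff zero_le_divide_1_iff)
    then show ?thesis
      using C k by (intro add_right_mono mult_left_mono) (auto simp: dev of_nat_diff)
  qed
  also have "\<dots> = D * (1 + real (card ?A)) / 2 / sqrt (real k - 1)"
  proof -
    define s where "s = sqrt (real k - 1)"
    have "s * s = real k - 1" "s > 0" using k by (auto simp: s_def)
    then have "C * (1 / (real k - 1)) = D / 2 / s"
      unfolding C_def \<epsilon>_def s_def[symmetric] by (simp flip: \<open>s * s = real k - 1\<close>)
    then have "C * (1 / (real k - 1)) = D / 2 / sqrt (real k - 1)"
      unfolding s_def .
    then show ?thesis
      unfolding B_def \<epsilon>_def by (simp add: distrib_left add_divide_distrib)
  qed
  finally show ?thesis by (simp add: bseq_def)
qed

lemma convergent_bseq: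
  assumes "xs \<noteq> []"
  shows "convergent (bseq \<sigma> xs)"
proof -
  define D where "D = (\<Sum>x\<in>set xs. \<Sum>y\<in>set xs. dist x y)"
  have "dist x y \<le> D" if "x \<in> set xs" "y \<in> set xs" for x y
  proof -
    have "dist x y \<le> (\<Sum>y\<in>set xs. dist x y)"
      using that by (intro member_le_sum) auto
    also have "\<dots> \<le> D"
      unfolding D_def using that by (intro member_le_sum[of x]) (auto intro!: sum_nonneg)
    finally show ?thesis .
  qed
  moreover have "0 \<le> D" unfolding D_def by (intro sum_nonneg) auto
  ultimately have "dist (bseq \<sigma> xs (k + m)) (bseq \<sigma> xs k)
      \<le> D * (1 + real (card (set xs))) / 2 / sqrt (real k - 1)" if "k \<ge> 2" for k m
    using assms that by (intro bseq_dist_le) auto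
  moreover have "(\<lambda>k. D * (1 + real (card (set xs))) / 2 / sqrt (real k - 1)) \<longlonglongrightarrow> 0"
  proof (intro tendsto_divide_0[OF tendsto_const] filterlim_at_top_imp_at_infinity
      filterlim_compose[OF sqrt_at_top])
    show "filterlim (\<lambda>k. real k - 1) at_top sequentially"
      using filterlim_tendsto_add_at_top[OF tendsto_const[of "-1"] filterlim_real_sequentially]
      by (simp add: add.commute)
  qed
  ultimately show ?thesis by (rule convergent_if_tail_bound)
qed

end

section \<open>Optimal assignments and Lipschitz potentials\<close>

fun walk_weight :: "('a \<Rightarrow> 'a \<Rightarrow> real) \<Rightarrow> 'a list \<Rightarrow> real" where
  "walk_weight w (i # j # is) = w i j + walk_weight w (j # is)"
| "walk_weight w _ = 0"

lemma walk_weight_append: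
  "walk_weight w (xs @ i # ys) = walk_weight w (xs @ [i]) + walk_weight w (i # ys)"
  by (induction w xs rule: walk_weight.induct) (auto simp: neq_Nil_conv split: list.splits)

lemma walk_weight_conv_sum:
  "walk_weight w xs = (\<Sum>k<length xs - 1. w (xs ! k) (xs ! Suc k))"
proof (induction w xs rule: walk_weight.induct)
  case (1 w i j xs)
  then show ?case by (simp add: sum.lessThan_Suc_shift del: sum.lessThan_Suc)
qed auto

text \<open>
  A closed walk through distinct vertices is the orbit of a cyclic permutation, so nonnegativity of
  all permutation sums forbids simple cycles of negative weight.
\<close>

lemma simple_cycle_weight_nonneg:
  fixes w :: "nat \<Rightarrow> nat \<Rightarrow> real"
  assumes diag: "\<And>i. w i i = 0"
    and perm: "\<And>\<pi>. \<pi> permutes {..<n} \<Longrightarrow> 0 \<le> (\<Sum>i<n. w i (\<pi> i))"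
    and xs: "distinct (i # xs)" "set (i # xs) \<subseteq> {..<n}"
  shows "0 \<le> walk_weight w (i # xs @ [i])"
proof -
  let ?c = "i # xs"
  let ?\<pi> = "cycle_of_list ?c"
  have "map ?\<pi> ?c = rotate1 ?c"
    using cyclic_rotation[OF xs(1), of 1] by simp
  then have step: "?\<pi> (?c ! k) = (?c @ [i]) ! Suc k" if "k < length ?c" for k
    using that by (metis nth_map rotate1.simps(2) append_Cons nth_Cons_Suc)
  have "?\<pi> permutes {..<n}"
    using cycle_permutes xs(2) permutes_subset by blast
  then have "0 \<le> (\<Sum>j<n. w j (?\<pi> j))"
    by (rule perm)
  also have "\<dots> = (\<Sum>j\<in>set ?c. w j (?\<pi> j))"
    using xs(2) by (intro sum.mono_neutral_right) (auto simp: diag id_outside_supp simp del: cycle_of_list.simps)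
  also have "\<dots> = (\<Sum>k<length ?c. w (?c ! k) (?\<pi> (?c ! k)))"
    using xs(1) by (intro sum.reindex_bij_betw[symmetric] bij_betw_nth) auto
  also have "\<dots> = (\<Sum>k<length ?c. w ((?c @ [i]) ! k) ((?c @ [i]) ! Suc k))"
    by (intro sum.cong refl arg_cong2[where f = w] step) (simp_all add: nth_append del: append_Cons)
  also have "\<dots> = walk_weight w (?c @ [i])"
    by (simp add: walk_weight_conv_sum)
  finally show ?thesis by simp
qed

text \<open>
  The potential of a vertex is the least weight of a simple path leading to it. Extending an optimal
  path by one edge either gives a simple path again or closes a cycle, and cutting off a cycle
  of nonnegative weight leaves a simple path that is at least as good.
\<close>

lemma exists_potential:
  fixes w :: "nat \<Rightarrow> nat \<Rightarrow> real"
  assumes diag: "\<And>i. w i i = 0"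
    and perm: "\<And>\<pi>. \<pi> permutes {..<n} \<Longrightarrow> 0 \<le> (\<Sum>i<n. w i (\<pi> i))"
  obtains u where "\<And>i j. i < n \<Longrightarrow> j < n \<Longrightarrow> u j \<le> u i + w i j"
proof -
  \<comment> \<open>Simple paths ending in \<open>j\<close>, without their last vertex.\<close>
  define P where "P = (\<lambda>j. {p. distinct (p @ [j]) \<and> set (p @ [j]) \<subseteq> {..<n}})"
  define u where "u = (\<lambda>j. Min ((\<lambda>p. walk_weight w (p @ [j])) ` P j))"
  have fin: "finite (P j)" for j
  proof (rule finite_subset)
    show "P j \<subseteq> {p. set p \<subseteq> {..<n} \<and> distinct p}" unfolding P_def by auto
  qed (use finite_subset_distinct[of "{..<n}"] in simp)
  have ne: "[] \<in> P j" if "j < n" for j using that by (simp add: P_def)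
  have u_le: "u j \<le> walk_weight w (p @ [j])" if "p \<in> P j" for p j
    unfolding u_def using fin that by (intro Min_le) auto
  have u_attained: "\<exists>p\<in>P j. u j = walk_weight w (p @ [j])" if "j < n" for j
  proof -
    have "u j \<in> (\<lambda>p. walk_weight w (p @ [j])) ` P j"
      unfolding u_def using fin ne[OF that] by (intro Min_in) auto
    then show ?thesis by auto
  qed
  have "u j \<le> u i + w i j" if "i < n" "j < n" for i j
  proof -
    obtain p where p: "p \<in> P i" "u i = walk_weight w (p @ [i])"
      using u_attained[OF \<open>i < n\<close>] by blast
    have extend: "walk_weight w (p @ [i, j]) = u i + w i j"
      using p(2) walk_weight_append[of w p i "[j]"] by simp
    show ?thesis
    proof (cases "j \<in> set (p @ [i])")
      case False
      then have "p @ [i] \<in> P j"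
        using p(1) that by (auto simp: P_def)
      then show ?thesis
        using u_le[of "p @ [i]" j] extend by simp
    next
      case True
      then obtain q r where qr: "p @ [i] = q @ j # r"
        by (meson split_list)
      have "distinct (p @ [i])" "set (p @ [i]) \<subseteq> {..<n}"
        using p(1) unfolding P_def by auto
      then have "distinct (q @ j # r)" "set (q @ j # r) \<subseteq> {..<n}"
        unfolding qr .
      then have "q \<in> P j" "distinct (j # r)" "set (j # r) \<subseteq> {..<n}"
        by (auto simp: P_def)
      then have "u j \<le> walk_weight w (q @ [j])" "0 \<le> walk_weight w (j # r @ [j])"
        using u_le simple_cycle_weight_nonneg[of w n, OF diag perm] by auto
      moreover have "p @ [i, j] = q @ j # r @ [j]"
        using qr by (metis append.assoc append_Cons append_Nil)
      then have "u i + w i j = walk_weight w (q @ [j]) + walk_weight w (j # r @ [j])"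
        using extend walk_weight_append[of w q j "r @ [j]"] by metis
      ultimately show ?thesis by linarith
    qed
  qed
  with that show thesis by blast
qed

text \<open>
  This is Kantorovich duality for two samples of equal size: an optimal assignment is
  complemented by a \<open>1\<close>-Lipschitz function that decreases by the full distance along every assigned
  pair. The function extends the potential of the reduced costs in McShane's way.
\<close>

lemma optimal_assignment_duality:
  fixes xs ys :: "'a::metric_space list"
  assumes len: "length xs = n" "length ys = n" and n: "n > 0"
  obtains zs f where "mset zs = mset ys" "1-lipschitz_on UNIV f"
    "tuple_dist xs zs \<le> (\<Sum>x\<leftarrow>xs. f x) - (\<Sum>y\<leftarrow>ys. f y)"
proof -
  define c where "c = (\<lambda>\<pi>. \<Sum>i<n. dist (xs ! i) (ys ! \<pi> i))"
  have "finite {\<pi>. \<pi> permutes {..<n}}" by (rule finite_permutations) simp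
  moreover have "id \<in> {\<pi>. \<pi> permutes {..<n}}" by (simp add: permutes_id)
  ultimately obtain \<pi> where "is_arg_min c (\<lambda>\<pi>. \<pi> \<in> {\<pi>. \<pi> permutes {..<n}}) \<pi>"
    using ex_is_arg_min_if_finite[of "{\<pi>. \<pi> permutes {..<n}}" c] by blast
  then have \<pi>: "\<pi> permutes {..<n}" and min: "\<And>\<tau>. \<tau> permutes {..<n} \<Longrightarrow> c \<pi> \<le> c \<tau>"
    by (auto simp: is_arg_min_linorder)
  define zs where "zs = map (\<lambda>i. ys ! \<pi> i) [0..<n]"
  have zs: "length zs = n" "\<And>i. i < n \<Longrightarrow> zs ! i = ys ! \<pi> i" by (simp_all add: zs_def)
  have mset_zs: "mset zs = mset ys"
    using mset_permute_list[of \<pi> ys] \<pi> len by (simp add: permute_list_def zs_def)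
  \<comment> \<open>The change of cost when \<open>x\<^sub>j\<close> takes over the partner of \<open>x\<^sub>i\<close>. Optimality of the assignment says
    that no permutation of the partners has negative total change.\<close>
  define w where "w = (\<lambda>i j. if i < n \<and> j < n then dist (xs ! j) (zs ! i) - dist (xs ! i) (zs ! i) else 0)"
  have perm: "0 \<le> (\<Sum>i<n. w i (\<tau> i))" if \<tau>: "\<tau> permutes {..<n}" for \<tau>
  proof -
    have inv: "inv \<tau> permutes {..<n}" using \<tau> by (rule permutes_inv)
    have "(\<Sum>i<n. dist (xs ! \<tau> i) (zs ! i)) = (\<Sum>i<n. dist (xs ! \<tau> (inv \<tau> i)) (zs ! inv \<tau> i))"
      by (rule sum.permute[OF inv, unfolded o_def])
    also have "\<dots> = (\<Sum>i<n. dist (xs ! i) (ys ! (\<pi> \<circ> inv \<tau>) i))"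
    proof (rule sum.cong[OF refl])
      fix i assume "i \<in> {..<n}"
      then have "inv \<tau> i < n" using inv by (simp add: permutes_in_image flip: lessThan_iff)
      then show "dist (xs ! \<tau> (inv \<tau> i)) (zs ! inv \<tau> i) = dist (xs ! i) (ys ! (\<pi> \<circ> inv \<tau>) i)"
        using \<tau> by (simp add: zs(2) permutes_inverses)
    qed
    also have "\<dots> \<ge> c \<pi>"
      using min[OF permutes_compose[OF inv \<pi>]] by (simp add: c_def)
    finally have "c \<pi> \<le> (\<Sum>i<n. dist (xs ! \<tau> i) (zs ! i))" .
    moreover have "\<tau> i < n" if "i < n" for i
      using \<tau> that by (simp add: permutes_in_image flip: lessThan_iff)
    ultimately show ?thesis
      by (simp add: w_def c_def zs sum_subtractf)
  qed
  have diag: "w i i = 0" for i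
    by (simp add: w_def)
  obtain u where u: "\<And>i j. i < n \<Longrightarrow> j < n \<Longrightarrow> u j \<le> u i + w i j"
    using exists_potential[of w n, OF diag perm] by blast
  define f where "f = (\<lambda>z. Min ((\<lambda>i. u i + dist z (zs ! i) - dist (xs ! i) (zs ! i)) ` {..<n}))"
  have f_le: "f z \<le> u i + dist z (zs ! i) - dist (xs ! i) (zs ! i)" if "i < n" for i z
    unfolding f_def using that by (intro Min_le) auto
  have f_ge: "r \<le> f z" if "\<And>i. i < n \<Longrightarrow> r \<le> u i + dist z (zs ! i) - dist (xs ! i) (zs ! i)" for r z
    unfolding f_def using that n by (intro Min.boundedI) auto
  have bound: "f y \<le> f z + dist y z" for y z
  proof -
    have "f y - dist y z \<le> f z"
    proof (rule f_ge)
      fix i assume "i < n"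
      then show "f y - dist y z \<le> u i + dist z (zs ! i) - dist (xs ! i) (zs ! i)"
        using f_le[of i y] dist_triangle[of y "zs ! i" z] by simp
    qed
    then show ?thesis by simp
  qed
  have lip: "1-lipschitz_on UNIV f"
  proof (rule lipschitz_onI)
    show "dist (f y) (f z) \<le> 1 * dist y z" for y z
      using bound[of y z] bound[of z y] by (simp add: dist_real_def abs_le_iff dist_commute)
  qed simp
  have "f (zs ! i) + dist (xs ! i) (zs ! i) \<le> f (xs ! i)" if "i < n" for i
  proof -
    have "u i \<le> f (xs ! i)"
      using u that by (intro f_ge) (fastforce simp: w_def)
    then show ?thesis using f_le[OF that, of "zs ! i"] by simp
  qed
  then have "(\<Sum>i<n. f (zs ! i) + dist (xs ! i) (zs ! i)) \<le> (\<Sum>i<n. f (xs ! i))"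
    by (intro sum_mono) simp
  then have "tuple_dist xs zs \<le> (\<Sum>x\<leftarrow>xs. f x) - (\<Sum>y\<leftarrow>zs. f y)"
    using len zs(1) by (simp add: tuple_dist_conv_sum sum_list_map_conv_sum sum.distrib)
  also have "(\<Sum>y\<leftarrow>zs. f y) = (\<Sum>y\<leftarrow>ys. f y)"
    using mset_zs by (metis mset_map sum_mset_sum_list)
  finally show thesis using that mset_zs lip by blast
qed

section \<open>First moments and the Wasserstein distance\<close>

lemma borel_measurable_lipschitz:
  fixes f :: "'a::metric_space \<Rightarrow> 'b::metric_space"
  assumes "1-lipschitz_on UNIV f"
  shows "f \<in> borel_measurable borel"
  using assms by (intro borel_measurable_continuous_onI lipschitz_on_continuous_on)

lemma lipschitz_dist: "1-lipschitz_on UNIV (\<lambda>x. dist x z)"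
  by (intro lipschitz_onI) (auto simp: dist_real_def abs_le_iff algebra_simps
      intro: dist_triangle dist_triangle3)

lemma lipschitz_le: "1-lipschitz_on UNIV (f :: 'a::metric_space \<Rightarrow> real) \<Longrightarrow> f x - f y \<le> dist x y"
  using lipschitz_onD[of 1 UNIV f x y] by (simp add: dist_real_def)

lemma P1_D:
  assumes "\<mu> \<in> P1"
  shows "prob_space \<mu>" "sets \<mu> = sets borel" "space \<mu> = UNIV"
  using assms sets_eq_imp_space_eq[of \<mu> borel] by (auto simp: P1_def radon_prob_def)

lemma integrable_lipschitz:
  fixes f :: "'a::metric_space \<Rightarrow> real"
  assumes \<mu>: "\<mu> \<in> P1" and f: "1-lipschitz_on UNIV f"
  shows "integrable \<mu> f"
proof -
  interpret prob_space \<mu> using P1_D[OF \<mu>] by simp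
  obtain x0 where x0: "integrable \<mu> (\<lambda>x. dist x x0)"
    using \<mu> unfolding P1_def by blast
  have "integrable \<mu> (\<lambda>x. \<bar>f x0\<bar> + dist x x0)"
    using x0 by simp
  moreover have "f \<in> borel_measurable \<mu>"
    using borel_measurable_lipschitz[OF f] P1_D(2)[OF \<mu>] by (simp cong: measurable_cong_sets)
  moreover have "norm (f x) \<le> norm (\<bar>f x0\<bar> + dist x x0)" for x
    using lipschitz_onD[OF f, of x x0] by (simp add: dist_real_def)
  ultimately show ?thesis
    by (rule Bochner_Integration.integrable_bound[OF _ _ always_eventually[OF allI]])
qed

text \<open>
  The real supremum in the definition of \<open>W1\<close> is meaningful only if it is finite. Since both
  measures have mass \<open>1\<close>, the additive constant \<open>f x0\<close> cancels and only first moments remain.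
\<close>

lemma W1_bdd_above:
  fixes \<mu> :: "'a::metric_space measure"
  assumes \<mu>: "\<mu> \<in> P1" and \<nu>: "\<nu> \<in> P1"
  shows "bdd_above ((\<lambda>f. integral\<^sup>L \<mu> f - integral\<^sup>L \<nu> f) ` {f :: 'a \<Rightarrow> real. 1-lipschitz_on UNIV f})"
proof -
  fix x0 :: 'a
  have "integral\<^sup>L \<mu> f - integral\<^sup>L \<nu> f \<le> (\<integral>x. dist x x0 \<partial>\<mu>) + (\<integral>x. dist x x0 \<partial>\<nu>)"
    if f: "1-lipschitz_on UNIV f" for f :: "'a \<Rightarrow> real"
  proof -
    interpret \<mu>: prob_space \<mu> using P1_D[OF \<mu>] by simp
    interpret \<nu>: prob_space \<nu> using P1_D[OF \<nu>] by simp
    note int = integrable_lipschitz[OF \<mu> f] integrable_lipschitz[OF \<nu> f]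
      integrable_lipschitz[OF \<mu> lipschitz_dist[of x0]] integrable_lipschitz[OF \<nu> lipschitz_dist[of x0]]
    have "integral\<^sup>L \<mu> f \<le> (\<integral>x. f x0 + dist x x0 \<partial>\<mu>)"
      using lipschitz_le[OF f, of _ x0] int by (intro integral_mono) (auto simp: algebra_simps)
    moreover have "(\<integral>x. f x0 - dist x x0 \<partial>\<nu>) \<le> integral\<^sup>L \<nu> f"
      using lipschitz_le[OF f, of x0] int by (intro integral_mono) (auto simp: algebra_simps dist_commute)
    ultimately show ?thesis
      using int by (simp add: \<mu>.prob_space \<nu>.prob_space)
  qed
  then show ?thesis by (intro bdd_aboveI2) auto
qed

lemma W1_upper:
  assumes "\<mu> \<in> P1" "\<nu> \<in> P1" "1-lipschitz_on UNIV f"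
  shows "integral\<^sup>L \<mu> f - integral\<^sup>L \<nu> f \<le> W1 \<mu> \<nu>"
  unfolding W1_def using assms W1_bdd_above by (intro cSUP_upper) auto

lemma W1_least:
  fixes \<mu> \<nu> :: "'a::metric_space measure"
  assumes "\<And>f :: 'a \<Rightarrow> real. 1-lipschitz_on UNIV f \<Longrightarrow> integral\<^sup>L \<mu> f - integral\<^sup>L \<nu> f \<le> r"
  shows "W1 \<mu> \<nu> \<le> r"
proof -
  have "1-lipschitz_on UNIV (\<lambda>x::'a. 0 :: real)" by (intro lipschitz_onI) auto
  then show ?thesis
    unfolding W1_def using assms by (intro cSUP_least) auto
qed

lemma W1_commute:
  fixes \<mu> \<nu> :: "'a::metric_space measure"
  assumes "\<mu> \<in> P1" "\<nu> \<in> P1"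
  shows "W1 \<mu> \<nu> = W1 \<nu> \<mu>"
proof -
  have "W1 \<mu> \<nu> \<le> W1 \<nu> \<mu>" if "\<mu> \<in> P1" "\<nu> \<in> P1" for \<mu> \<nu> :: "'a measure"
  proof (rule W1_least)
    fix f :: "'a \<Rightarrow> real"
    assume f: "1-lipschitz_on UNIV f"
    then have "1-lipschitz_on UNIV (\<lambda>x. - f x)"
      by simp
    then have "integral\<^sup>L \<nu> (\<lambda>x. - f x) - integral\<^sup>L \<mu> (\<lambda>x. - f x) \<le> W1 \<nu> \<mu>"
      using that by (intro W1_upper)
    then show "integral\<^sup>L \<mu> f - integral\<^sup>L \<nu> f \<le> W1 \<nu> \<mu>" by simp
  qed
  with assms show ?thesis by (intro antisym)
qed

lemma W1_triangle:
  assumes "\<mu> \<in> P1" "\<nu> \<in> P1" "\<rho> \<in> P1"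
  shows "W1 \<mu> \<rho> \<le> W1 \<mu> \<nu> + W1 \<nu> \<rho>"
proof (rule W1_least)
  fix f :: "'a \<Rightarrow> real"
  assume "1-lipschitz_on UNIV f"
  then show "integral\<^sup>L \<mu> f - integral\<^sup>L \<rho> f \<le> W1 \<mu> \<nu> + W1 \<nu> \<rho>"
    using W1_upper[OF assms(1,2)] W1_upper[OF assms(2,3)] by fastforce
qed

lemma W1_self: "W1 \<mu> \<mu> \<le> 0"
  by (intro W1_least) simp

lemma lipschitz_compose_1:
  assumes "1-lipschitz_on UNIV f" "1-lipschitz_on UNIV g"
  shows "1-lipschitz_on UNIV (\<lambda>x. f (g x))"
proof (rule lipschitz_onI)
  fix x y
  have "dist (f (g x)) (f (g y)) \<le> 1 * dist (g x) (g y)"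
    using lipschitz_onD[OF assms(1)] by blast
  also have "\<dots> \<le> 1 * dist x y"
    using lipschitz_onD[OF assms(2), of x y] by simp
  finally show "dist (f (g x)) (f (g y)) \<le> 1 * dist x y" .
qed simp

lemma measurable_lipschitz_P1:
  assumes "1-lipschitz_on UNIV \<phi>" "\<mu> \<in> P1"
  shows "\<phi> \<in> measurable \<mu> borel"
  using borel_measurable_lipschitz[OF assms(1)] P1_D(2)[OF assms(2)] by (simp cong: measurable_cong_sets)

text \<open>
  Inner regularity is preserved because continuous images of compact sets are compact.
\<close>

lemma distr_lipschitz_in_P1:
  fixes \<phi> :: "'a::metric_space \<Rightarrow> 'a"
  assumes \<phi>: "1-lipschitz_on UNIV \<phi>" and \<mu>: "\<mu> \<in> P1"
  shows "distr \<mu> borel \<phi> \<in> P1"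
proof -
  have meas: "\<phi> \<in> measurable \<mu> borel" using \<phi> \<mu> by (rule measurable_lipschitz_P1)
  have "prob_space (distr \<mu> borel \<phi>)"
    using P1_D[OF \<mu>] meas by (intro prob_space.prob_space_distr)
  moreover have "emeasure (distr \<mu> borel \<phi>) B
      = (SUP K\<in>{K. compact K \<and> K \<subseteq> B}. emeasure (distr \<mu> borel \<phi>) K)" if B: "B \<in> sets borel" for B
  proof (rule antisym)
    have vB: "\<phi> -` B \<in> sets borel"
      using measurable_sets[OF borel_measurable_lipschitz[OF \<phi>] B] by simp
    have "emeasure (distr \<mu> borel \<phi>) B = emeasure \<mu> (\<phi> -` B)"
      using B meas P1_D(3)[OF \<mu>] by (simp add: emeasure_distr)
    also have "\<dots> = (SUP K\<in>{K. compact K \<and> K \<subseteq> \<phi> -` B}. emeasure \<mu> K)"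
      using \<mu> vB by (simp add: P1_def radon_prob_def)
    also have "\<dots> \<le> (SUP K\<in>{K. compact K \<and> K \<subseteq> B}. emeasure (distr \<mu> borel \<phi>) K)"
    proof (rule SUP_mono)
      fix K assume K: "K \<in> {K. compact K \<and> K \<subseteq> \<phi> -` B}"
      have cK: "compact (\<phi> ` K)"
        using K by (intro compact_continuous_image continuous_on_subset[OF lipschitz_on_continuous_on[OF \<phi>]]) auto
      then have "\<phi> ` K \<in> sets borel" by (simp add: borel_compact)
      then have "emeasure (distr \<mu> borel \<phi>) (\<phi> ` K) = emeasure \<mu> (\<phi> -` (\<phi> ` K))" "\<phi> -` (\<phi> ` K) \<in> sets \<mu>"
        using meas P1_D[OF \<mu>] measurable_sets[OF meas] by (simp_all add: emeasure_distr)
      then have "emeasure \<mu> K \<le> emeasure (distr \<mu> borel \<phi>) (\<phi> ` K)"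
        by (auto intro!: emeasure_mono)
      with cK K show "\<exists>K'\<in>{K. compact K \<and> K \<subseteq> B}. emeasure \<mu> K \<le> emeasure (distr \<mu> borel \<phi>) K'"
        by (intro bexI[of _ "\<phi> ` K"]) auto
    qed
    finally show "emeasure (distr \<mu> borel \<phi>) B
      \<le> (SUP K\<in>{K. compact K \<and> K \<subseteq> B}. emeasure (distr \<mu> borel \<phi>) K)" .
    show "(SUP K\<in>{K. compact K \<and> K \<subseteq> B}. emeasure (distr \<mu> borel \<phi>) K) \<le> emeasure (distr \<mu> borel \<phi>) B"
      using B by (intro SUP_least emeasure_mono) auto
  qed
  moreover have "integrable (distr \<mu> borel \<phi>) (\<lambda>x. dist x x0)" for x0
    using integrable_lipschitz[OF \<mu> lipschitz_compose_1[OF lipschitz_dist[of x0] \<phi>]] meas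
      borel_measurable_lipschitz[OF lipschitz_dist[of x0]]
    by (subst integrable_distr_eq) auto
  ultimately show ?thesis
    by (simp add: P1_def radon_prob_def)
qed

lemma W1_distr_le:
  fixes \<phi> :: "'a::metric_space \<Rightarrow> 'a"
  assumes \<phi>: "1-lipschitz_on UNIV \<phi>" and \<mu>: "\<mu> \<in> P1" and \<nu>: "\<nu> \<in> P1"
  shows "W1 (distr \<mu> borel \<phi>) (distr \<nu> borel \<phi>) \<le> W1 \<mu> \<nu>"
proof (rule W1_least)
  fix f :: "'a \<Rightarrow> real"
  assume f: "1-lipschitz_on UNIV f"
  have "integral\<^sup>L (distr \<rho> borel \<phi>) f = integral\<^sup>L \<rho> (\<lambda>x. f (\<phi> x))" if "\<rho> \<in> P1" for \<rho>
    using measurable_lipschitz_P1[OF \<phi> that] borel_measurable_lipschitz[OF f] by (rule integral_distr)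
  then show "integral\<^sup>L (distr \<mu> borel \<phi>) f - integral\<^sup>L (distr \<nu> borel \<phi>) f \<le> W1 \<mu> \<nu>"
    using W1_upper[OF \<mu> \<nu> lipschitz_compose_1[OF f \<phi>]] \<mu> \<nu> by simp
qed

section \<open>Empirical measures\<close>

lemma emeasure_empirical:
  "B \<in> sets borel \<Longrightarrow>
    emeasure (empirical xs) B = (\<Sum>x\<leftarrow>xs. ennreal (1 / real (length xs)) * indicator B x)"
  by (simp add: empirical_def emeasure_dirac_comb sum_list_map_conv_sum)

lemma sets_empirical [simp]: "sets (empirical xs) = sets borel"
  and space_empirical [simp]: "space (empirical xs) = UNIV"
  by (simp_all add: empirical_def)

lemma empirical_eqI:
  assumes "sets M = sets borel"
    and "\<And>B. B \<in> sets borel \<Longrightarrow>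
      emeasure M B = (\<Sum>x\<leftarrow>xs. ennreal (1 / real (length xs)) * indicator B x)"
  shows "M = empirical xs"
  using assms by (intro measure_eqI) (auto simp: emeasure_empirical)

lemma return_eq_empirical: "return borel x = empirical [x]"
  by (intro empirical_eqI) (auto simp: ennreal_1)

lemma distr_empirical:
  assumes "\<phi> \<in> borel_measurable borel"
  shows "distr (empirical xs) borel \<phi> = empirical (map \<phi> xs)"
proof (rule empirical_eqI)
  fix B :: "'b set" assume B: "B \<in> sets borel"
  then have "\<phi> -` B \<in> sets borel"
    using measurable_sets[OF assms B] by simp
  then show "emeasure (distr (empirical xs) borel \<phi>) B
    = (\<Sum>x\<leftarrow>map \<phi> xs. ennreal (1 / real (length (map \<phi> xs))) * indicator B x)"
    using B assms by (simp add: emeasure_distr emeasure_empirical o_def indicator_vimage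
        measurable_cong_sets[OF sets_empirical refl])
qed simp

text \<open>
  This representation gives access to the integration theory of finite sums.
\<close>

lemma empirical_eq_distr:
  "empirical xs = distr (point_measure {..<length xs} (\<lambda>_. 1 / real (length xs))) borel ((!) xs)"
proof (rule empirical_eqI[symmetric])
  let ?n = "length xs"
  fix B :: "'a set" assume B: "B \<in> sets borel"
  have "emeasure (distr (point_measure {..<?n} (\<lambda>_. 1 / real ?n)) borel ((!) xs)) B
    = emeasure (point_measure {..<?n} (\<lambda>_. 1 / real ?n)) ((!) xs -` B \<inter> {..<?n})"
    using B by (subst emeasure_distr) (auto simp: space_point_measure)
  also have "\<dots> = (\<Sum>i\<in>(!) xs -` B \<inter> {..<?n}. ennreal (1 / real ?n))"
    by (subst emeasure_point_measure_finite2) auto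
  also have "\<dots> = (\<Sum>i<?n. ennreal (1 / real ?n) * indicator B (xs ! i))"
    by (intro sum.mono_neutral_cong_left) (auto simp: indicator_def)
  finally show "emeasure (distr (point_measure {..<?n} (\<lambda>_. 1 / real ?n)) borel ((!) xs)) B
    = (\<Sum>x\<leftarrow>xs. ennreal (1 / real (length xs)) * indicator B x)"
    by (simp add: sum_list_map_conv_sum)
qed simp

lemma integral_empirical:
  fixes f :: "'a::topological_space \<Rightarrow> real"
  assumes "f \<in> borel_measurable borel"
  shows "integral\<^sup>L (empirical xs) f = (\<Sum>x\<leftarrow>xs. f x) / real (length xs)"
  unfolding empirical_eq_distr using assms
  by (subst integral_distr)
    (auto simp: lebesgue_integral_point_measure_finite sum_list_map_conv_sum sum_divide_distrib)

lemma empirical_in_P1: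
  fixes xs :: "'a::metric_space list"
  assumes xs: "xs \<noteq> []"
  shows "empirical xs \<in> P1"
proof -
  let ?p = "point_measure {..<length xs} (\<lambda>_. ennreal (1 / real (length xs)))"
  have "emeasure (empirical xs) UNIV = 1"
    using xs by (subst emeasure_empirical)
      (auto simp: sum_list_triv ennreal_of_nat_eq_real_of_nat ennreal_mult[symmetric])
  then have "prob_space (empirical xs)"
    by (intro prob_spaceI) simp
  moreover have "emeasure (empirical xs) B = (SUP K\<in>{K. compact K \<and> K \<subseteq> B}. emeasure (empirical xs) K)"
    if B: "B \<in> sets borel" for B
  proof (rule antisym)
    have K: "compact (B \<inter> set xs)" by (intro finite_imp_compact) simp
    have "emeasure (empirical xs) B = emeasure (empirical xs) (B \<inter> set xs)"
      using B borel_compact[OF K]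
      by (simp add: emeasure_empirical indicator_def cong: map_cong)
    also have "\<dots> \<le> (SUP K\<in>{K. compact K \<and> K \<subseteq> B}. emeasure (empirical xs) K)"
      using K by (intro SUP_upper) auto
    finally show "emeasure (empirical xs) B \<le> (SUP K\<in>{K. compact K \<and> K \<subseteq> B}. emeasure (empirical xs) K)" .
    show "(SUP K\<in>{K. compact K \<and> K \<subseteq> B}. emeasure (empirical xs) K) \<le> emeasure (empirical xs) B"
      using B by (intro SUP_least emeasure_mono) auto
  qed
  moreover have "integrable (empirical xs) (\<lambda>x. dist x x0)" for x0
    unfolding empirical_eq_distr
    using borel_measurable_lipschitz[OF lipschitz_dist[of x0]]
    by (subst integrable_distr_eq) (auto simp: point_measure_def integrable_density integrable_count_space)
  ultimately show ?thesis
    by (simp add: P1_def radon_prob_def)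
qed

text \<open>
  The tuple that realizes integer multiplicities; a rational combination of Dirac measures is
  the empirical measure of such a tuple, with a common denominator as its length.
\<close>

definition repeat_each :: "('b \<Rightarrow> nat) \<Rightarrow> ('b \<Rightarrow> 'a) \<Rightarrow> 'b list \<Rightarrow> 'a list" where
  "repeat_each a x ks = concat (map (\<lambda>k. replicate (a k) (x k)) ks)"

lemma sum_list_repeat_each:
  fixes f :: "'a \<Rightarrow> 'c::comm_semiring_1"
  shows "(\<Sum>y\<leftarrow>repeat_each a x ks. f y) = (\<Sum>k\<leftarrow>ks. of_nat (a k) * f (x k))"
proof -
  have "sum_list (replicate m c) = of_nat m * c" for m and c :: 'c
    by (induction m) (auto simp: algebra_simps)
  then show ?thesis
    by (induction ks) (auto simp: repeat_each_def)
qed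

lemma length_repeat_each: "length (repeat_each a x ks) = (\<Sum>k\<leftarrow>ks. a k)"
  by (induction ks) (auto simp: repeat_each_def)

lemma PQ_eq_empirical:
  assumes "\<mu> \<in> PQ"
  obtains xs where "xs \<noteq> []" "\<mu> = empirical xs"
proof -
  obtain n \<alpha> x where \<mu>: "\<mu> = dirac_comb n \<alpha> x" and \<alpha>: "\<forall>k<n. \<alpha> k \<in> \<rat> \<and> 0 \<le> \<alpha> k" "(\<Sum>k<n. \<alpha> k) = 1"
    using assms unfolding PQ_def by blast
  have "\<exists>m d. d \<noteq> 0 \<and> \<alpha> k = real m / real d" if "k < n" for k
    using \<alpha>(1) that Rats_abs_nat_div_natE[of "\<alpha> k"] by (metis abs_of_nonneg)
  then obtain m d where md: "\<And>k. k < n \<Longrightarrow> d k \<noteq> 0" "\<And>k. k < n \<Longrightarrow> \<alpha> k = real (m k) / real (d k)"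
    by metis
  define N where "N = (\<Prod>k<n. d k)"
  define a where "a = (\<lambda>k. m k * (\<Prod>j\<in>{..<n} - {k}. d j))"
  have N: "N > 0" using md(1) by (auto simp: N_def intro: Nat.gr0I)
  have a: "\<alpha> k = real (a k) / real N" if "k < n" for k
  proof -
    have "N = d k * (\<Prod>j\<in>{..<n} - {k}. d j)"
      unfolding N_def using that by (intro prod.remove) auto
    then show ?thesis using md[OF that] N by (simp add: a_def)
  qed
  define xs where "xs = repeat_each a x [0..<n]"
  have "real (\<Sum>k<n. a k) = real N"
    using \<alpha>(2) a N by (simp add: sum_divide_distrib[symmetric])
  then have len: "length xs = N"
    by (simp add: xs_def length_repeat_each interv_sum_list_conv_sum_set_nat atLeast0LessThan del: of_nat_sum)
  have "\<mu> = empirical xs"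
  proof (rule empirical_eqI)
    fix B :: "'a set" assume "B \<in> sets borel"
    then have "emeasure \<mu> B = (\<Sum>k<n. ennreal (\<alpha> k) * indicator B (x k))"
      by (simp add: \<mu> emeasure_dirac_comb)
    also have "\<dots> = (\<Sum>k<n. of_nat (a k) * (ennreal (1 / real N) * indicator B (x k)))"
    proof (rule sum.cong[OF refl])
      fix k assume "k \<in> {..<n}"
      then have "ennreal (\<alpha> k) = ennreal (real (a k)) * ennreal (1 / real N)"
        using a by (simp flip: ennreal_mult)
      then show "ennreal (\<alpha> k) * indicator B (x k) = of_nat (a k) * (ennreal (1 / real N) * indicator B (x k))"
        by (simp add: ennreal_of_nat_eq_real_of_nat mult.assoc)
    qed
    also have "\<dots> = (\<Sum>y\<leftarrow>xs. ennreal (1 / real (length xs)) * indicator B y)"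
      unfolding xs_def[symmetric] len
      by (simp add: xs_def sum_list_repeat_each interv_sum_list_conv_sum_set_nat atLeast0LessThan)
    finally show "emeasure \<mu> B = (\<Sum>y\<leftarrow>xs. ennreal (1 / real (length xs)) * indicator B y)" .
  qed (simp add: \<mu>)
  moreover have "xs \<noteq> []" using len N by auto
  ultimately show thesis using that by blast
qed

section \<open>Density of empirical measures\<close>

lemma closed_spt: "closed (spt \<mu>)"
proof -
  have "- spt \<mu> = \<Union>{U. open U \<and> emeasure \<mu> U = 0}"
    unfolding spt_def by (auto simp: zero_less_iff_neq_zero)
  moreover have "open \<dots>" by (intro open_Union) auto
  ultimately show ?thesis by (simp add: closed_def)
qed

text \<open>
  A compact set that misses the support is covered by finitely many open null sets. Only inner
  regularity turns this into a statement about the whole complement of the support.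
\<close>

lemma emeasure_spt:
  assumes "radon_prob \<mu>"
  shows "emeasure \<mu> (spt \<mu>) = 1"
proof -
  interpret prob_space \<mu> using assms by (simp add: radon_prob_def)
  have sets: "sets \<mu> = sets borel" and space: "space \<mu> = UNIV"
    using assms sets_eq_imp_space_eq[of \<mu> borel] by (auto simp: radon_prob_def)
  have "emeasure \<mu> K = 0" if K: "compact K" "K \<subseteq> - spt \<mu>" for K
  proof -
    have "K \<subseteq> \<Union>{U. open U \<and> emeasure \<mu> U = 0}"
      using K(2) unfolding spt_def by (auto simp: zero_less_iff_neq_zero)
    then obtain \<U> where \<U>: "\<U> \<subseteq> {U. open U \<and> emeasure \<mu> U = 0}" "finite \<U>" "K \<subseteq> \<Union>\<U>"
      using compactE[OF K(1), of "{U. open U \<and> emeasure \<mu> U = 0}"] by blast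
    have "\<U> \<subseteq> null_sets \<mu>"
      using \<U>(1) sets by (auto simp: null_sets_def)
    then have "\<Union>\<U> \<in> null_sets \<mu>"
      using \<U>(2) null_sets_UN'[of \<U> "\<lambda>U. U" \<mu>] countable_finite by auto
    then show ?thesis
      using \<U>(3) by (metis emeasure_mono le_zero_eq null_setsD1 null_setsD2)
  qed
  moreover have "- spt \<mu> \<in> sets borel"
    using closed_spt[of \<mu>] by (intro borel_open) auto
  ultimately have "emeasure \<mu> (- spt \<mu>) = 0"
    using assms unfolding radon_prob_def by (auto intro!: SUP_eq_const simp: SUP_eq_iff)
  then have "prob (space \<mu> - spt \<mu>) = 0"
    using space by (simp add: measure_def Compl_eq_Diff_UNIV)
  moreover have "spt \<mu> \<in> events"
    using closed_spt[of \<mu>] sets by simp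
  ultimately show ?thesis
    using prob_compl[of "spt \<mu>"] by (simp add: emeasure_eq_measure)
qed

text \<open>
  A measurable projection to finitely many points: the first center within distance \<open>e\<close> for points of
  \<open>K\<close>, the base point elsewhere. The recursion over a list replaces a partition of \<open>K\<close> into small
  Borel sets.
\<close>

fun nearby_center :: "'a::metric_space set \<Rightarrow> real \<Rightarrow> 'a \<Rightarrow> 'a list \<Rightarrow> 'a \<Rightarrow> 'a" where
  "nearby_center K e x0 [] x = x0"
| "nearby_center K e x0 (c # cs) x = (if x \<in> K \<inter> ball c e then c else nearby_center K e x0 cs x)"

lemma nearby_center_in: "nearby_center K e x0 cs x \<in> insert x0 (set cs)"
  by (induction cs) auto

lemma nearby_center_outside: "x \<notin> K \<Longrightarrow> nearby_center K e x0 cs x = x0"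
  by (induction cs) auto

lemma nearby_center_dist:
  "x \<in> K \<Longrightarrow> x \<in> (\<Union>c\<in>set cs. ball c e) \<Longrightarrow> dist x (nearby_center K e x0 cs x) < e"
  by (induction cs) (auto simp: dist_commute)

lemma nearby_center_measurable:
  assumes "K \<in> sets borel"
  shows "nearby_center K e x0 cs \<in> borel_measurable borel"
proof (induction cs)
  case (Cons c cs)
  have "K \<inter> ball c e \<in> sets borel" using assms by (intro sets.Int) auto
  then have "(\<lambda>x. if x \<in> K \<inter> ball c e then c else nearby_center K e x0 cs x) \<in> borel_measurable borel"
    using Cons by (intro measurable_If_set) auto
  then show ?case by (simp cong: measurable_cong)
qed simp

lemma exists_tail_integral_less:
  fixes g :: "'a \<Rightarrow> real"
  assumes g: "integrable \<mu> g" and e: "e > 0"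
  obtains R :: nat where "(\<integral>x. indicator {x. real R < g x} x * g x \<partial>\<mu>) < e"
proof -
  have [measurable]: "g \<in> borel_measurable \<mu>" using g by simp
  have "(\<lambda>R::nat. \<integral>x. indicator {x. real R < g x} x * g x \<partial>\<mu>) \<longlonglongrightarrow> (\<integral>x. 0 \<partial>\<mu>)"
  proof (rule integral_dominated_convergence[where w = "\<lambda>x. \<bar>g x\<bar>"])
    show "AE x in \<mu>. (\<lambda>R::nat. indicator {x. real R < g x} x * g x) \<longlonglongrightarrow> 0"
    proof (rule AE_I2)
      fix x
      obtain R0 :: nat where "g x \<le> real R0" using real_arch_simple by blast
      then have "eventually (\<lambda>R::nat. indicator {x. real R < g x} x * g x = 0) sequentially"
        unfolding eventually_sequentially by (intro exI[of _ R0]) auto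
      then show "(\<lambda>R::nat. indicator {x. real R < g x} x * g x) \<longlonglongrightarrow> 0"
        by (rule tendsto_eventually)
    qed
  qed (use g in \<open>auto simp: indicator_def\<close>)
  then have "eventually (\<lambda>R::nat. (\<integral>x. indicator {x. real R < g x} x * g x \<partial>\<mu>) < e) sequentially"
    using e by (intro order_tendstoD(2)) auto
  then show thesis using that by (auto simp: eventually_sequentially)
qed

text \<open>
  Rounding the weights of a finitely supported probability down to multiples of \<open>1/M\<close> and giving
  the rest to one point moves total mass at most \<open>1/M\<close> from each point to that one.
\<close>

lemma round_weights:
  fixes \<alpha> :: "'a::metric_space \<Rightarrow> real"
  assumes S: "finite S" "x0 \<in> S" and \<alpha>: "\<And>c. c \<in> S \<Longrightarrow> 0 \<le> \<alpha> c" "(\<Sum>c\<in>S. \<alpha> c) = 1" and M: "M > 0"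
  obtains xs where "length xs = M" "set xs \<subseteq> S"
    "\<And>f :: 'a \<Rightarrow> real. 1-lipschitz_on UNIV f \<Longrightarrow>
      \<bar>(\<Sum>c\<in>S. \<alpha> c * f c) - (\<Sum>x\<leftarrow>xs. f x) / real M\<bar> \<le> (\<Sum>c\<in>S. dist c x0) / real M"
proof -
  obtain ss where ss: "set ss = S" "distinct ss"
    using finite_distinct_list[OF S(1)] by blast
  define a where "a = (\<lambda>c. nat \<lfloor>real M * \<alpha> c\<rfloor>)"
  define r where "r = M - (\<Sum>c\<in>S. a c)"
  define xs where "xs = repeat_each a id ss @ replicate r x0"
  have a: "real (a c) \<le> real M * \<alpha> c" "real M * \<alpha> c \<le> real (a c) + 1" if "c \<in> S" for c
    using \<alpha>(1)[OF that] M unfolding a_def by (auto intro!: mult_nonneg_nonneg)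
  have "real (\<Sum>c\<in>S. a c) \<le> (\<Sum>c\<in>S. real M * \<alpha> c)"
    using a by (simp add: sum_mono)
  also have "\<dots> = real M" using \<alpha>(2) by (simp flip: sum_distrib_left)
  finally have "(\<Sum>c\<in>S. a c) \<le> M" by linarith
  then have r: "real r = real M - (\<Sum>c\<in>S. real (a c))" and len: "length xs = M"
    using ss by (simp_all add: r_def of_nat_diff xs_def length_repeat_each sum_list_distinct_conv_sum_set)
  have "\<bar>(\<Sum>c\<in>S. \<alpha> c * f c) - (\<Sum>x\<leftarrow>xs. f x) / real M\<bar> \<le> (\<Sum>c\<in>S. dist c x0) / real M"
    if f: "1-lipschitz_on UNIV f" for f :: "'a \<Rightarrow> real"
  proof -
    have "(\<Sum>x\<leftarrow>xs. f x) = (\<Sum>c\<in>S. real (a c) * f c) + real r * f x0"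
      using ss by (simp add: xs_def sum_list_repeat_each sum_list_distinct_conv_sum_set sum_list_replicate)
    also have "\<dots> = (\<Sum>c\<in>S. real (a c) * (f c - f x0)) + real M * f x0"
      by (simp add: r algebra_simps sum_subtractf sum_distrib_left)
    finally have "real M * (\<Sum>c\<in>S. \<alpha> c * f c) - (\<Sum>x\<leftarrow>xs. f x)
      = real M * (\<Sum>c\<in>S. \<alpha> c * f c) - real M * (\<Sum>c\<in>S. \<alpha> c) * f x0 - (\<Sum>c\<in>S. real (a c) * (f c - f x0))"
      using \<alpha>(2) by simp
    also have "\<dots> = (\<Sum>c\<in>S. (real M * \<alpha> c - real (a c)) * (f c - f x0))"
      by (simp add: algebra_simps sum_subtractf sum.distrib sum_distrib_left sum_distrib_right)
    also have "\<bar>\<dots>\<bar> \<le> (\<Sum>c\<in>S. dist c x0)"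
    proof (rule order_trans[OF sum_abs sum_mono])
      fix c assume c: "c \<in> S"
      have "\<bar>real M * \<alpha> c - real (a c)\<bar> * \<bar>f c - f x0\<bar> \<le> 1 * dist c x0"
        using a[OF c] lipschitz_onD[OF f, of c x0] by (intro mult_mono) (auto simp: dist_real_def)
      then show "\<bar>(real M * \<alpha> c - real (a c)) * (f c - f x0)\<bar> \<le> dist c x0"
        by (simp add: abs_mult)
    qed
    finally have "\<bar>real M * (\<Sum>c\<in>S. \<alpha> c * f c) - (\<Sum>x\<leftarrow>xs. f x)\<bar> / real M \<le> (\<Sum>c\<in>S. dist c x0) / real M"
      by (intro divide_right_mono) auto
    also have "\<bar>real M * (\<Sum>c\<in>S. \<alpha> c * f c) - (\<Sum>x\<leftarrow>xs. f x)\<bar> / real M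
      = \<bar>(real M * (\<Sum>c\<in>S. \<alpha> c * f c) - (\<Sum>x\<leftarrow>xs. f x)) / real M\<bar>"
      by (simp only: abs_divide abs_of_nat)
    also have "(real M * (\<Sum>c\<in>S. \<alpha> c * f c) - (\<Sum>x\<leftarrow>xs. f x)) / real M
      = (\<Sum>c\<in>S. \<alpha> c * f c) - (\<Sum>x\<leftarrow>xs. f x) / real M"
      using M by (simp add: diff_divide_distrib)
    finally show ?thesis .
  qed
  moreover have "set xs \<subseteq> S"
    using ss S(2) by (auto simp: xs_def repeat_each_def)
  ultimately show thesis using that len by blast
qed

lemma integral_finite_range:
  fixes T :: "'a::t1_space \<Rightarrow> 'a" and f :: "'a \<Rightarrow> real"
  assumes "prob_space \<mu>" "sets \<mu> = sets borel"
    and T: "T \<in> borel_measurable borel" and S: "finite S" "\<And>x. T x \<in> S"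
  shows "integrable \<mu> (\<lambda>x. f (T x))"
    and "(\<integral>x. f (T x) \<partial>\<mu>) = (\<Sum>c\<in>S. measure \<mu> (T -` {c}) * f c)"
proof -
  interpret prob_space \<mu> by fact
  have sets: "T -` {c} \<in> sets \<mu>" for c
    using measurable_sets[OF T, of "{c}"] assms(2) by simp
  have int: "integrable \<mu> (indicat_real (T -` {c}))" for c
    using sets by (intro integrable_real_indicator) (auto simp: less_top[symmetric])
  have eq: "f (T x) = (\<Sum>c\<in>S. indicator (T -` {c}) x * f c)" for x
  proof -
    have "(\<Sum>c\<in>S. indicator (T -` {c}) x * f c) = (\<Sum>c\<in>S. if c = T x then f c else 0)"
      by (intro sum.cong) (auto simp: indicator_def)
    then show ?thesis using S by simp
  qed
  show "integrable \<mu> (\<lambda>x. f (T x))"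
    unfolding eq using int by (intro Bochner_Integration.integrable_sum integrable_mult_left)
  show "(\<integral>x. f (T x) \<partial>\<mu>) = (\<Sum>c\<in>S. measure \<mu> (T -` {c}) * f c)"
    unfolding eq using int sets by (subst Bochner_Integration.integral_sum) auto
qed

text \<open>
  Inner regularity provides a compact set that carries all but a small part of the first moment.
  A finite net in this set, together with one base point for the remaining mass, gives a finitely
  supported measure nearby. The net and the base point can be taken in the support, which is what
  makes the barycenter local.
\<close>

lemma empirical_approximation:
  assumes \<mu>: "\<mu> \<in> P1" and e: "e > 0"
  obtains xs where "xs \<noteq> []" "set xs \<subseteq> spt \<mu>" "W1 \<mu> (empirical xs) \<le> e"
proof -
  interpret prob_space \<mu> using P1_D[OF \<mu>] by simp
  note sets = P1_D(2)[OF \<mu>] and space = P1_D(3)[OF \<mu>]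
  have radon: "radon_prob \<mu>" using \<mu> by (simp add: P1_def)
  obtain x0 where x0: "x0 \<in> spt \<mu>"
    using emeasure_spt[OF radon] by (cases "spt \<mu> = {}") auto
  define g where "g = (\<lambda>x. dist x x0)"
  have g: "integrable \<mu> g" unfolding g_def by (rule integrable_lipschitz[OF \<mu> lipschitz_dist])
  obtain R :: nat where R: "(\<integral>x. indicator {x. real R < g x} x * g x \<partial>\<mu>) < e / 4"
    using exists_tail_integral_less[OF g, of "e / 4"] e by auto
  define \<delta> where "\<delta> = e / (4 * (real R + 1))"
  have \<delta>: "\<delta> > 0" using e by (simp add: \<delta>_def)
  have "ennreal (1 - \<delta>) < emeasure \<mu> (spt \<mu>)"
    using \<delta> emeasure_spt[OF radon] by (simp add: ennreal_less_one_iff)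
  also have "emeasure \<mu> (spt \<mu>) = (SUP K\<in>{K. compact K \<and> K \<subseteq> spt \<mu>}. emeasure \<mu> K)"
    using radon closed_spt[of \<mu>] by (simp add: radon_prob_def)
  finally obtain K where K: "compact K" "K \<subseteq> spt \<mu>" "ennreal (1 - \<delta>) < emeasure \<mu> K"
    by (auto simp: less_SUP_iff)
  have K_sets: "K \<in> sets \<mu>" "K \<in> sets borel" using K(1) sets by (simp_all add: borel_compact)
  have "1 - \<delta> \<le> prob K"
    using K(3) by (simp add: emeasure_eq_measure ennreal_less_iff)
      (metis ennreal_less_iff ennreal_neg less_eq_real_def linorder_not_le measure_nonneg order_trans)
  then have compl_K: "prob (- K) \<le> \<delta>"
    using prob_compl[OF K_sets(1)] space by (simp add: Compl_eq_Diff_UNIV)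
  obtain C where C: "finite C" "C \<subseteq> K" "K \<subseteq> (\<Union>c\<in>C. ball c (e / 4))"
    using seq_compact_imp_totally_bounded[OF compact_imp_seq_compact[OF K(1)]] e by (meson divide_pos_pos zero_less_numeral)
  obtain cs where cs: "set cs = C" using finite_list[OF C(1)] by blast
  define T where "T = nearby_center K (e / 4) x0 cs"
  define S where "S = insert x0 C"
  have S: "finite S" "x0 \<in> S" "S \<subseteq> spt \<mu>" using C K(2) x0 by (auto simp: S_def)
  have T_S: "T x \<in> S" for x unfolding T_def S_def using nearby_center_in cs by metis
  have T_meas: "T \<in> borel_measurable borel"
    unfolding T_def using K_sets(2) by (rule nearby_center_measurable)
  note T_int = integral_finite_range[OF prob_space_axioms sets T_meas S(1) T_S]
  \<comment> \<open>An integrable bound for the transport cost: \<open>e/4\<close> on \<open>K\<close>, and off \<open>K\<close> the distance to the base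
    point, split at the height \<open>R\<close>.\<close>
  define h where "h = (\<lambda>x. e / 4 + real R * indicator (- K) x + indicator {x. real R < g x} x * g x)"
  have dist_T: "dist x (T x) \<le> h x" for x
  proof (cases "x \<in> K")
    case True
    then have "x \<in> (\<Union>c\<in>set cs. ball c (e / 4))"
      using C(3) unfolding cs by blast
    then have "dist x (T x) < e / 4"
      unfolding T_def by (rule nearby_center_dist[OF True])
    moreover have "0 \<le> real R * indicator (- K) x" "0 \<le> indicator {x. real R < g x} x * g x"
      by (auto simp: g_def)
    ultimately show ?thesis
      unfolding h_def by linarith
  next
    case False
    then have "T x = x0" unfolding T_def by (rule nearby_center_outside)
    then show ?thesis
      using False e by (auto simp: h_def g_def indicator_def)
  qed
  have g_meas: "g \<in> borel_measurable \<mu>" using g by simp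
  have "{x \<in> space \<mu>. real R < g x} \<in> sets \<mu>" using g_meas by measurable
  then have tail_int: "integrable \<mu> (\<lambda>x. indicator {x. real R < g x} x * g x)"
    using integrable_real_mult_indicator[OF _ g] space by (simp add: mult.commute)
  have ind_int: "integrable \<mu> (\<lambda>x. real R * indicator (- K) x)"
    using K_sets space sets.compl_sets[of K \<mu>] by (auto simp: Compl_eq_Diff_UNIV emeasure_finite less_top[symmetric])
  have h_int: "integrable \<mu> h"
    unfolding h_def using tail_int ind_int by simp
  have "integral\<^sup>L \<mu> h = e / 4 + real R * prob (- K) + (\<integral>x. indicator {x. real R < g x} x * g x \<partial>\<mu>)"
    unfolding h_def using tail_int ind_int space prob_space by simp
  also have "real R * prob (- K) \<le> e / 4"
  proof -
    have "real R * prob (- K) \<le> (real R + 1) * \<delta>"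
      using compl_K by (intro mult_mono) auto
    also have "\<dots> = e / 4"
    proof -
      have "real R + 1 \<noteq> 0" by linarith
      then show ?thesis
        unfolding \<delta>_def by (metis mult.commute nonzero_mult_divide_mult_cancel_left times_divide_eq_right)
    qed
    finally show ?thesis .
  qed
  finally have h_le: "integral\<^sup>L \<mu> h \<le> 3 * e / 4" using R by simp
  define \<alpha> where "\<alpha> = (\<lambda>c. measure \<mu> (T -` {c}))"
  have \<alpha>: "(\<Sum>c\<in>S. \<alpha> c) = 1"
    using T_int(2)[of "\<lambda>_. 1"] by (simp add: \<alpha>_def prob_space)
  obtain M :: nat where M: "M > 0" "(\<Sum>c\<in>S. dist c x0) / real M \<le> e / 4"
  proof -
    obtain M :: nat where "4 * (\<Sum>c\<in>S. dist c x0) / e \<le> real M" using real_arch_simple by blast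
    then have "(\<Sum>c\<in>S. dist c x0) / real (Suc M) \<le> e / 4"
      using e by (simp add: field_simps)
    then show thesis using that[of "Suc M"] by simp
  qed
  obtain xs where xs: "length xs = M" "set xs \<subseteq> S"
    "\<And>f :: 'a \<Rightarrow> real. 1-lipschitz_on UNIV f \<Longrightarrow>
      \<bar>(\<Sum>c\<in>S. \<alpha> c * f c) - (\<Sum>x\<leftarrow>xs. f x) / real M\<bar> \<le> (\<Sum>c\<in>S. dist c x0) / real M"
    using round_weights[OF S(1,2) _ \<alpha> M(1)] by (auto simp: \<alpha>_def)
  have "W1 \<mu> (empirical xs) \<le> e"
  proof (rule W1_least)
    fix f :: "'a \<Rightarrow> real"
    assume f: "1-lipschitz_on UNIV f"
    have "integral\<^sup>L \<mu> f - (\<integral>x. f (T x) \<partial>\<mu>) = (\<integral>x. f x - f (T x) \<partial>\<mu>)"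
      using integrable_lipschitz[OF \<mu> f] T_int(1) by simp
    also have "\<dots> \<le> integral\<^sup>L \<mu> h"
      using integrable_lipschitz[OF \<mu> f] T_int(1) h_int
        order_trans[OF lipschitz_le[OF f] dist_T] by (intro integral_mono) auto
    finally have "integral\<^sup>L \<mu> f - (\<Sum>c\<in>S. \<alpha> c * f c) \<le> 3 * e / 4"
      using h_le T_int(2) by (simp add: \<alpha>_def)
    moreover have "integral\<^sup>L (empirical xs) f = (\<Sum>x\<leftarrow>xs. f x) / real M"
      using integral_empirical[OF borel_measurable_lipschitz[OF f]] xs(1) by simp
    ultimately show "integral\<^sup>L \<mu> f - integral\<^sup>L (empirical xs) f \<le> e"
      using xs(3)[OF f] M(2) by linarith
  qed
  moreover have "xs \<noteq> []" using xs(1) M(1) by auto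
  ultimately show thesis using that xs(2) S(3) by blast
qed

section \<open>The barycenter\<close>

context midpoint_bicombing
begin

abbreviation list_barycenter :: "'a list \<Rightarrow> 'a" where
  "list_barycenter xs \<equiv> lim (bseq \<sigma> xs)"

lemma bseq_tendsto: "xs \<noteq> [] \<Longrightarrow> bseq \<sigma> xs \<longlonglongrightarrow> list_barycenter xs"
  using convergent_bseq by (simp add: convergent_LIMSEQ_iff)

lemma bmap_mean: "xs \<noteq> [] \<Longrightarrow> k \<ge> 1 \<Longrightarrow> contracting_mean (length xs * k) (bmap \<sigma> (length xs * k))"
  by (intro contracting_mean_bmap) (simp add: Suc_le_eq)

lemma list_barycenter_singleton: "list_barycenter [x] = x"
proof -
  have "Qrep k [x] = replicate k x" for k
    by (induction k) auto
  then have "bseq \<sigma> [x] k = x" if "k \<ge> 1" for k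
    using bmap_mean[of "[x]" k] that by (simp add: bseq_def contracting_mean_def)
  then have "eventually (\<lambda>k. bseq \<sigma> [x] k = x) sequentially"
    unfolding eventually_sequentially by blast
  then have "bseq \<sigma> [x] \<longlonglongrightarrow> x" by (rule tendsto_eventually)
  then show ?thesis by (rule limI)
qed

text \<open>
  Repeating the tuple passes to a subsequence of the defining sequence.
\<close>

lemma list_barycenter_Qrep:
  assumes "xs \<noteq> []" "j \<ge> 1"
  shows "list_barycenter (Qrep j xs) = list_barycenter xs"
proof -
  have eq: "bseq \<sigma> (Qrep j xs) = (\<lambda>k. bseq \<sigma> xs (k * j))"
    by (simp add: bseq_def Qrep_Qrep algebra_simps fun_eq_iff)
  have "strict_mono (\<lambda>k. k * j)"
    using assms(2) by (intro strict_monoI) simp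
  then have "(\<lambda>k. bseq \<sigma> xs (k * j)) \<longlonglongrightarrow> list_barycenter xs"
    using LIMSEQ_subseq_LIMSEQ[OF bseq_tendsto[OF assms(1)]] by (simp add: o_def)
  then show ?thesis unfolding eq by (rule limI)
qed

text \<open>
  Repeating a tuple multiplies its length and the assignment cost by the same factor, so the
  contraction property of the maps \<open>b\<^sub>n\<close> survives in the limit.
\<close>

lemma list_barycenter_assignment:
  assumes xs: "xs \<noteq> []" and len: "length zs = length xs" "mset zs = mset ys"
  shows "real (length xs) * dist (list_barycenter xs) (list_barycenter ys) \<le> tuple_dist xs zs"
proof -
  let ?n = "length xs"
  have ys: "length ys = ?n" "ys \<noteq> []" using xs len by (metis size_mset, metis length_0_conv size_mset)
  have "real ?n * dist (bseq \<sigma> xs k) (bseq \<sigma> ys k) \<le> tuple_dist xs zs" if k: "k \<ge> 1" for k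
  proof -
    have eq: "mset (Qrep k zs) = mset (Qrep k ys)"
      using len(2) by (intro multiset_eqI) (simp add: count_mset_Qrep)
    have "length (Qrep k zs) = ?n * k"
      using len(1) by (simp add: mult.commute)
    from mean_sym[OF bmap_mean[OF xs k] this eq]
    have "bseq \<sigma> ys k = bmap \<sigma> (?n * k) (Qrep k zs)"
      by (simp only: bseq_def ys(1))
    moreover have "real (?n * k) * dist (bmap \<sigma> (?n * k) (Qrep k xs)) (bmap \<sigma> (?n * k) (Qrep k zs))
        \<le> tuple_dist (Qrep k xs) (Qrep k zs)"
      using len(1) by (intro mean_dist[OF bmap_mean[OF xs k]]) (simp_all add: mult.commute)
    ultimately have "real k * (real ?n * dist (bseq \<sigma> xs k) (bseq \<sigma> ys k)) \<le> real k * tuple_dist xs zs"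
      using len(1) by (simp add: bseq_def tuple_dist_Qrep algebra_simps)
    then show ?thesis using k by simp
  qed
  moreover have "(\<lambda>k. real ?n * dist (bseq \<sigma> xs k) (bseq \<sigma> ys k))
      \<longlonglongrightarrow> real ?n * dist (list_barycenter xs) (list_barycenter ys)"
    using bseq_tendsto xs ys(2) by (intro tendsto_intros)
  ultimately show ?thesis by (intro LIMSEQ_le_const2) auto
qed

text \<open>
  Repeating each sample as often as the other one is long makes the samples equally long without
  changing averages or barycenters, so the duality for assignments applies.
\<close>

lemma dist_list_barycenter_le_W1:
  assumes xs: "xs \<noteq> []" and ys: "ys \<noteq> []"
  shows "dist (list_barycenter xs) (list_barycenter ys) \<le> W1 (empirical xs) (empirical ys)"
proof -
  define xs' where "xs' = Qrep (length ys) xs"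
  define ys' where "ys' = Qrep (length xs) ys"
  define N where "N = length xs'"
  have len: "length xs' = N" "length ys' = N" by (simp_all add: xs'_def ys'_def N_def)
  have pos: "length xs \<ge> 1" "length ys \<ge> 1" using xs ys by (simp_all add: Suc_le_eq)
  then have N: "N > 0" using xs ys by (simp add: N_def xs'_def)
  obtain zs f where zs: "mset zs = mset ys'" and f: "1-lipschitz_on UNIV f"
    and dual: "tuple_dist xs' zs \<le> (\<Sum>x\<leftarrow>xs'. f x) - (\<Sum>y\<leftarrow>ys'. f y)"
    using optimal_assignment_duality[OF len N] by blast
  have ne: "xs' \<noteq> []" using N by (auto simp: N_def)
  have "length zs = N" using zs len by (metis size_mset)
  then have "real N * dist (list_barycenter xs') (list_barycenter ys') \<le> tuple_dist xs' zs"
    using list_barycenter_assignment[of xs' zs ys', OF ne] zs len by simp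
  also note dual
  also have "(\<Sum>x\<leftarrow>xs'. f x) - (\<Sum>y\<leftarrow>ys'. f y)
    = real N * ((\<Sum>x\<leftarrow>xs. f x) / real (length xs) - (\<Sum>y\<leftarrow>ys. f y) / real (length ys))"
  proof -
    have "(\<Sum>x\<leftarrow>Qrep k us. f x) = real k * (\<Sum>x\<leftarrow>us. f x)" for k us
      by (induction k) (auto simp: algebra_simps)
    then show ?thesis
      using pos by (simp add: N_def xs'_def ys'_def right_diff_distrib)
  qed
  also have "\<dots> = real N * (integral\<^sup>L (empirical xs) f - integral\<^sup>L (empirical ys) f)"
    by (simp add: integral_empirical borel_measurable_lipschitz[OF f])
  also have "\<dots> \<le> real N * W1 (empirical xs) (empirical ys)"
    using W1_upper[OF empirical_in_P1[OF xs] empirical_in_P1[OF ys] f] by (intro mult_left_mono) auto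
  finally have "dist (list_barycenter xs') (list_barycenter ys') \<le> W1 (empirical xs) (empirical ys)"
    using N by simp
  then show ?thesis
    using xs ys pos by (simp add: xs'_def ys'_def list_barycenter_Qrep)
qed

lemma list_barycenter_in_closed:
  assumes C: "closed C" "\<And>x y. x \<in> C \<Longrightarrow> y \<in> C \<Longrightarrow> \<sigma> x y (1/2) \<in> C"
    and xs: "xs \<noteq> []" "set xs \<subseteq> C"
  shows "list_barycenter xs \<in> C"
proof (rule closed_sequentially[OF C(1)])
  show "(\<lambda>k. bseq \<sigma> xs (Suc k)) \<longlonglongrightarrow> list_barycenter xs"
    using bseq_tendsto[OF xs(1)] by (rule LIMSEQ_Suc)
  show "bseq \<sigma> xs (Suc k) \<in> C" for k
    unfolding bseq_def using xs set_Qrep_subset[of "Suc k" xs]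
    by (intro bmap_in_closed[OF C]) (auto simp: Suc_le_eq simp del: Qrep_simps)
qed

lemma list_barycenter_equivariant:
  assumes \<phi>: "1-lipschitz_on UNIV \<phi>" "sigma_equivariant \<sigma> \<phi>" and xs: "xs \<noteq> []"
  shows "\<phi> (list_barycenter xs) = list_barycenter (map \<phi> xs)"
proof -
  have cont: "continuous_on UNIV \<phi>" using \<phi>(1) by (rule lipschitz_on_continuous_on)
  have eq: "\<phi> (\<sigma> x y (1/2)) = \<sigma> (\<phi> x) (\<phi> y) (1/2)" for x y
    using \<phi>(2) unfolding sigma_equivariant_def by simp
  have "\<phi> (bseq \<sigma> xs (Suc k)) = bseq \<sigma> (map \<phi> xs) (Suc k)" for k
  proof -
    have "length xs * Suc k \<ge> 1" "length (Qrep (Suc k) xs) = length xs * Suc k"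
      using xs by (simp_all add: Suc_le_eq del: Qrep_simps)
    from bmap_equivariant[where \<phi> = \<phi>, OF cont eq this]
    show ?thesis by (simp only: bseq_def map_Qrep length_map)
  qed
  moreover have "(\<lambda>k. \<phi> (bseq \<sigma> xs (Suc k))) \<longlonglongrightarrow> \<phi> (list_barycenter xs)"
    using cont LIMSEQ_Suc[OF bseq_tendsto[OF xs]]
    by (intro isCont_tendsto_compose[where g = \<phi>]) (auto simp: continuous_on_eq_continuous_at)
  moreover have "(\<lambda>k. bseq \<sigma> (map \<phi> xs) (Suc k)) \<longlonglongrightarrow> list_barycenter (map \<phi> xs)"
    using xs by (intro LIMSEQ_Suc bseq_tendsto) simp
  ultimately show ?thesis using LIMSEQ_unique by (simp only:)
qed

text \<open>
  The convex hull is an increasing union of the iterated steps, so two of its points lie in a common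
  step. The closure follows by continuity of the midpoint.
\<close>

lemma midpoint_in_closure_sigma_conv:
  assumes "x \<in> closure (sigma_conv \<sigma> A)" "y \<in> closure (sigma_conv \<sigma> A)"
  shows "\<sigma> x y (1/2) \<in> closure (sigma_conv \<sigma> A)"
proof -
  let ?C = "sigma_conv \<sigma> A"
  have mono: "(conv_step \<sigma> ^^ k) A \<subseteq> (conv_step \<sigma> ^^ (k + l)) A" for k l
  proof (induction l)
    case (Suc l)
    have "B \<subseteq> conv_step \<sigma> B" for B
    proof
      fix b assume "b \<in> B"
      moreover have "\<sigma> b b 0 = b" using bicombing by (simp add: conical_geodesic_bicombing_def)
      ultimately show "b \<in> conv_step \<sigma> B"
        unfolding conv_step_def by (force intro: exI[of _ b] exI[of _ "0::real"])
    qed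
    with Suc show ?case by simp blast
  qed simp
  have mid: "\<sigma> u v (1/2) \<in> ?C" if uv: "u \<in> ?C" "v \<in> ?C" for u v
  proof -
    obtain k l where "u \<in> (conv_step \<sigma> ^^ k) A" "v \<in> (conv_step \<sigma> ^^ l) A"
      using uv unfolding sigma_conv_def by blast
    then have "u \<in> (conv_step \<sigma> ^^ (k + l)) A" "v \<in> (conv_step \<sigma> ^^ (k + l)) A"
      using mono[of k l] mono[of l k] by (auto simp: add.commute)
    then have "\<sigma> u v (1/2) \<in> (conv_step \<sigma> ^^ Suc (k + l)) A"
      unfolding funpow.simps o_apply conv_step_def[of _ "(conv_step \<sigma> ^^ (k + l)) A"] by force
    then show ?thesis unfolding sigma_conv_def by blast
  qed
  obtain u v where uv: "\<And>n. u n \<in> ?C" "u \<longlonglongrightarrow> x" "\<And>n. v n \<in> ?C" "v \<longlonglongrightarrow> y"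
    using assms unfolding closure_sequential by blast
  have "(\<lambda>n. \<sigma> (u n) (v n) (1/2)) \<longlonglongrightarrow> \<sigma> x y (1/2)"
  proof (rule tendsto_dist_iff[THEN iffD2], rule Lim_null_comparison[OF always_eventually[OF allI]])
    fix n
    have "real 2 * dist (bmap \<sigma> 2 [u n, v n]) (bmap \<sigma> 2 [x, y]) \<le> tuple_dist [u n, v n] [x, y]"
      by (rule mean_dist[OF contracting_mean_2]) simp_all
    then show "norm (dist (\<sigma> (u n) (v n) (1/2)) (\<sigma> x y (1/2))) \<le> (dist (u n) x + dist (v n) y) / 2"
      by (simp add: bmap_2 del: bmap.simps)
  next
    have "(\<lambda>n. dist (u n) x) \<longlonglongrightarrow> 0" "(\<lambda>n. dist (v n) y) \<longlonglongrightarrow> 0"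
      using uv(2,4) by (blast intro: tendsto_dist_iff[THEN iffD1])+
    then show "(\<lambda>n. (dist (u n) x + dist (v n) y) / 2) \<longlonglongrightarrow> 0"
      by (intro tendsto_divide_zero tendsto_add_zero)
  qed
  then show ?thesis
  proof (rule closed_sequentially[OF closed_closure, rotated])
    show "\<sigma> (u n) (v n) (1/2) \<in> closure ?C" for n
      using mid[OF uv(1)[of n] uv(3)[of n]] by (rule closure_subset[THEN subsetD])
  qed
qed

text \<open>
  The approximating tuples are chosen with entries in the support; the barycenter is therefore a
  limit of points of the closed convex hull.
\<close>

definition approximant :: "'a measure \<Rightarrow> nat \<Rightarrow> 'a list" where
  "approximant \<mu> k = (SOME xs. xs \<noteq> [] \<and> set xs \<subseteq> spt \<mu> \<and> W1 \<mu> (empirical xs) \<le> 1 / real (Suc k))"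

definition barycenter :: "'a measure \<Rightarrow> 'a" where
  "barycenter \<mu> = lim (\<lambda>k. list_barycenter (approximant \<mu> k))"

context
  fixes \<mu> :: "'a measure"
  assumes \<mu>: "\<mu> \<in> P1"
begin

lemma approximant: "approximant \<mu> k \<noteq> []" "set (approximant \<mu> k) \<subseteq> spt \<mu>"
  and W1_approximant: "W1 \<mu> (empirical (approximant \<mu> k)) \<le> 1 / real (Suc k)"
proof -
  have "\<exists>xs. xs \<noteq> [] \<and> set xs \<subseteq> spt \<mu> \<and> W1 \<mu> (empirical xs) \<le> 1 / real (Suc k)"
    using empirical_approximation[OF \<mu>, of "1 / real (Suc k)"] by (metis of_nat_0_less_iff zero_less_Suc zero_less_divide_1_iff)
  from someI_ex[OF this] show "approximant \<mu> k \<noteq> []" "set (approximant \<mu> k) \<subseteq> spt \<mu>"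
    "W1 \<mu> (empirical (approximant \<mu> k)) \<le> 1 / real (Suc k)"
    unfolding approximant_def by auto
qed

lemma barycenter_tendsto: "(\<lambda>k. list_barycenter (approximant \<mu> k)) \<longlonglongrightarrow> barycenter \<mu>"
proof -
  have "convergent (\<lambda>k. list_barycenter (approximant \<mu> k))"
  proof (rule convergent_if_tail_bound)
    fix k m :: nat
    let ?x = "approximant \<mu> (k + m)" and ?y = "approximant \<mu> k"
    note P1 = empirical_in_P1[OF approximant(1)]
    have "dist (list_barycenter ?x) (list_barycenter ?y) \<le> W1 (empirical ?x) (empirical ?y)"
      using approximant(1) by (intro dist_list_barycenter_le_W1)
    also have "\<dots> \<le> W1 \<mu> (empirical ?x) + W1 \<mu> (empirical ?y)"
      using W1_triangle[OF P1 \<mu> P1] W1_commute[OF P1 \<mu>] by metis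
    also have "\<dots> \<le> 1 / real (Suc (k + m)) + 1 / real (Suc k)"
      by (intro add_mono W1_approximant)
    also have "\<dots> \<le> 1 / real (Suc k) + 1 / real (Suc k)"
      by (intro add_right_mono frac_le) auto
    finally show "dist (list_barycenter ?x) (list_barycenter ?y) \<le> 2 * (1 / real (Suc k))" by simp
  next
    show "(\<lambda>k. 2 * (1 / real (Suc k))) \<longlonglongrightarrow> 0"
      using LIMSEQ_inverse_real_of_nat by (intro tendsto_mult_right_zero) (simp add: inverse_eq_divide)
  qed
  then show ?thesis unfolding barycenter_def convergent_LIMSEQ_iff .
qed

lemma dist_barycenter_empirical_le:
  assumes xs: "xs \<noteq> []"
  shows "dist (barycenter \<mu>) (list_barycenter xs) \<le> W1 \<mu> (empirical xs)"
proof -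
  have "dist (list_barycenter (approximant \<mu> k)) (list_barycenter xs) \<le> 1 / real (Suc k) + W1 \<mu> (empirical xs)" for k
  proof -
    note P1 = empirical_in_P1[OF approximant(1)] empirical_in_P1[OF xs]
    have "dist (list_barycenter (approximant \<mu> k)) (list_barycenter xs)
        \<le> W1 (empirical (approximant \<mu> k)) (empirical xs)"
      using approximant(1) xs by (intro dist_list_barycenter_le_W1)
    also have "\<dots> \<le> W1 \<mu> (empirical (approximant \<mu> k)) + W1 \<mu> (empirical xs)"
      using W1_triangle[OF P1(1) \<mu> P1(2)] W1_commute[OF P1(1) \<mu>] by metis
    finally show ?thesis using W1_approximant[of k] by linarith
  qed
  moreover have "(\<lambda>k. dist (list_barycenter (approximant \<mu> k)) (list_barycenter xs))
      \<longlonglongrightarrow> dist (barycenter \<mu>) (list_barycenter xs)"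
    using barycenter_tendsto by (intro tendsto_intros)
  moreover have "(\<lambda>k. 1 / real (Suc k) + W1 \<mu> (empirical xs)) \<longlonglongrightarrow> 0 + W1 \<mu> (empirical xs)"
    using LIMSEQ_inverse_real_of_nat by (intro tendsto_add tendsto_const) (simp add: inverse_eq_divide)
  ultimately show ?thesis by (intro LIMSEQ_le) auto
qed

end

lemma dist_barycenter_le_W1:
  assumes \<mu>: "\<mu> \<in> P1" and \<nu>: "\<nu> \<in> P1"
  shows "dist (barycenter \<mu>) (barycenter \<nu>) \<le> W1 \<mu> \<nu>"
proof (rule field_le_epsilon)
  fix e :: real assume e: "e > 0"
  obtain xs where xs: "xs \<noteq> []" "W1 \<nu> (empirical xs) \<le> e / 2"
    using empirical_approximation[OF \<nu> half_gt_zero[OF e]] by blast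
  have "dist (barycenter \<mu>) (barycenter \<nu>) \<le> W1 \<mu> (empirical xs) + W1 \<nu> (empirical xs)"
    using dist_barycenter_empirical_le[OF \<mu> xs(1)] dist_barycenter_empirical_le[OF \<nu> xs(1)]
      dist_triangle2[of "barycenter \<mu>" "barycenter \<nu>" "list_barycenter xs"] by linarith
  also have "\<dots> \<le> W1 \<mu> \<nu> + e"
    using W1_triangle[OF \<mu> \<nu> empirical_in_P1[OF xs(1)]] xs(2) by linarith
  finally show "dist (barycenter \<mu>) (barycenter \<nu>) \<le> W1 \<mu> \<nu> + e" .
qed

lemma barycenter_empirical:
  assumes "xs \<noteq> []"
  shows "barycenter (empirical xs) = list_barycenter xs"
  using dist_barycenter_empirical_le[OF empirical_in_P1[OF assms] assms] W1_self[of "empirical xs"]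
  by (metis dist_le_zero_iff order_trans)

lemma contracting_barycenter: "contracting_barycenter_map barycenter"
  unfolding contracting_barycenter_map_def
  using dist_barycenter_le_W1 by (simp add: return_eq_empirical barycenter_empirical list_barycenter_singleton)

lemma barycenter_unique:
  assumes \<beta>: "contracting_barycenter_map \<beta>" "\<And>xs. xs \<noteq> [] \<Longrightarrow> \<beta> (empirical xs) = list_barycenter xs"
    and \<mu>: "\<mu> \<in> P1"
  shows "\<beta> \<mu> = barycenter \<mu>"
proof -
  have "dist (\<beta> \<mu>) (barycenter \<mu>) \<le> 0 + e" if e: "e > 0" for e
  proof -
    obtain xs where xs: "xs \<noteq> []" "W1 \<mu> (empirical xs) \<le> e / 2"
      using empirical_approximation[OF \<mu> half_gt_zero[OF e]] by blast
    have "dist (\<beta> \<mu>) (\<beta> (empirical xs)) \<le> W1 \<mu> (empirical xs)"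
      using \<beta>(1) \<mu> empirical_in_P1[OF xs(1)] by (simp add: contracting_barycenter_map_def)
    then show ?thesis
      using dist_barycenter_empirical_le[OF \<mu> xs(1)] xs \<beta>(2)[OF xs(1)]
        dist_triangle2[of "\<beta> \<mu>" "barycenter \<mu>" "list_barycenter xs"] by simp
  qed
  then have "dist (\<beta> \<mu>) (barycenter \<mu>) \<le> 0" by (rule field_le_epsilon)
  then show ?thesis by simp
qed

lemma barycenter_local:
  assumes \<mu>: "\<mu> \<in> P1"
  shows "barycenter \<mu> \<in> closure (sigma_conv \<sigma> (spt \<mu>))"
proof (rule closed_sequentially[OF closed_closure _ barycenter_tendsto[OF \<mu>]])
  fix k
  have "spt \<mu> \<subseteq> sigma_conv \<sigma> (spt \<mu>)"
    unfolding sigma_conv_def by (metis UN_upper UNIV_I funpow_0)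
  then have "set (approximant \<mu> k) \<subseteq> closure (sigma_conv \<sigma> (spt \<mu>))"
    using approximant(2)[OF \<mu>] closure_subset by blast
  then show "list_barycenter (approximant \<mu> k) \<in> closure (sigma_conv \<sigma> (spt \<mu>))"
    using approximant(1)[OF \<mu>] midpoint_in_closure_sigma_conv by (intro list_barycenter_in_closed) auto
qed

lemma barycenter_equivariant:
  assumes \<phi>: "1-lipschitz_on UNIV \<phi>" "sigma_equivariant \<sigma> \<phi>" and \<mu>: "\<mu> \<in> P1"
  shows "\<phi> (barycenter \<mu>) = barycenter (distr \<mu> borel \<phi>)"
proof -
  have "dist (\<phi> (barycenter \<mu>)) (barycenter (distr \<mu> borel \<phi>)) \<le> 0 + e" if e: "e > 0" for e
  proof -
    obtain xs where xs: "xs \<noteq> []" "W1 \<mu> (empirical xs) \<le> e / 2"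
      using empirical_approximation[OF \<mu> half_gt_zero[OF e]] by blast
    let ?p = "\<phi> (list_barycenter xs)"
    have "dist (\<phi> (barycenter \<mu>)) ?p \<le> dist (barycenter \<mu>) (list_barycenter xs)"
      using lipschitz_onD[OF \<phi>(1)] by fastforce
    also have "\<dots> \<le> e / 2"
      using dist_barycenter_empirical_le[OF \<mu> xs(1)] xs(2) by linarith
    finally have "dist (\<phi> (barycenter \<mu>)) ?p \<le> e / 2" .
    moreover have "dist (barycenter (distr \<mu> borel \<phi>)) ?p \<le> e / 2"
    proof -
      have "dist (barycenter (distr \<mu> borel \<phi>)) (list_barycenter (map \<phi> xs))
          \<le> W1 (distr \<mu> borel \<phi>) (empirical (map \<phi> xs))"
        using xs(1) distr_lipschitz_in_P1[OF \<phi>(1) \<mu>] by (intro dist_barycenter_empirical_le) auto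
      also have "\<dots> = W1 (distr \<mu> borel \<phi>) (distr (empirical xs) borel \<phi>)"
        by (simp add: distr_empirical borel_measurable_lipschitz[OF \<phi>(1)])
      also have "\<dots> \<le> W1 \<mu> (empirical xs)"
        by (intro W1_distr_le \<phi>(1) \<mu> empirical_in_P1 xs(1))
      finally show ?thesis
        using xs list_barycenter_equivariant[OF \<phi> xs(1)] by simp
    qed
    ultimately show ?thesis
      using dist_triangle2[of "\<phi> (barycenter \<mu>)" "barycenter (distr \<mu> borel \<phi>)" ?p] by linarith
  qed
  then have "dist (\<phi> (barycenter \<mu>)) (barycenter (distr \<mu> borel \<phi>)) \<le> 0" by (rule field_le_epsilon)
  then show ?thesis by simp
qed

lemma list_barycenter_cong:
  assumes "xs \<noteq> []" "ys \<noteq> []" "empirical xs = empirical ys"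
  shows "list_barycenter xs = list_barycenter ys"
  using barycenter_empirical[OF assms(1)] barycenter_empirical[OF assms(2)] assms(3) by simp

end

theorem theorem3p4:
  fixes \<sigma> :: "'a::complete_space \<Rightarrow> 'a \<Rightarrow> real \<Rightarrow> 'a"
  assumes "conical_geodesic_bicombing \<sigma>"
    and "midpoint_property \<sigma>"
  shows "(\<forall>xs. xs \<noteq> [] \<longrightarrow> convergent (bseq \<sigma> xs)) \<and>
    (\<forall>\<mu>\<in>PQ. \<exists>!p. \<exists>xs. xs \<noteq> [] \<and> \<mu> = empirical xs \<and> p = lim (bseq \<sigma> xs)) \<and>
    (\<exists>\<beta> :: 'a measure \<Rightarrow> 'a.
       contracting_barycenter_map \<beta> \<and>
       (\<forall>xs. xs \<noteq> [] \<longrightarrow> \<beta> (empirical xs) = lim (bseq \<sigma> xs)) \<and>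
       (\<forall>\<beta>'. contracting_barycenter_map \<beta>' \<and>
              (\<forall>xs. xs \<noteq> [] \<longrightarrow> \<beta>' (empirical xs) = lim (bseq \<sigma> xs)) \<longrightarrow>
              (\<forall>\<mu>\<in>P1. \<beta>' \<mu> = \<beta> \<mu>)) \<and>
       (\<forall>\<mu>\<in>P1. \<beta> \<mu> \<in> closure (sigma_conv \<sigma> (spt \<mu>))) \<and>
       (\<forall>\<phi>. 1-lipschitz_on UNIV \<phi> \<and> sigma_equivariant \<sigma> \<phi> \<longrightarrow>
              (\<forall>\<mu>\<in>P1. \<phi> (\<beta> \<mu>) = \<beta> (distr \<mu> borel \<phi>))))"
proof -
  interpret midpoint_bicombing \<sigma>
    using assms by unfold_locales
  show ?thesis
  proof (intro conjI allI impI ballI exI[of _ barycenter])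
    show "convergent (bseq \<sigma> xs)" if "xs \<noteq> []" for xs
      using convergent_bseq[OF that] .
  next
    fix \<mu> :: "'a measure"
    assume "\<mu> \<in> PQ"
    then obtain xs where "xs \<noteq> []" "\<mu> = empirical xs"
      by (rule PQ_eq_empirical)
    then show "\<exists>!p. \<exists>xs. xs \<noteq> [] \<and> \<mu> = empirical xs \<and> p = lim (bseq \<sigma> xs)"
      using list_barycenter_cong by blast
  next
    show "contracting_barycenter_map (barycenter)"
      by (rule contracting_barycenter)
    show "barycenter (empirical xs) = lim (bseq \<sigma> xs)" if "xs \<noteq> []" for xs
      using barycenter_empirical[OF that] .
    show "\<beta>' \<mu> = barycenter \<mu>" if "contracting_barycenter_map \<beta>' \<and>
        (\<forall>xs. xs \<noteq> [] \<longrightarrow> \<beta>' (empirical xs) = lim (bseq \<sigma> xs))" "\<mu> \<in> P1" for \<beta>' \<mu>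
      using that by (intro barycenter_unique) auto
    show "barycenter \<mu> \<in> closure (sigma_conv \<sigma> (spt \<mu>))" if "\<mu> \<in> P1" for \<mu>
      using barycenter_local[OF that] .
    show "\<phi> (barycenter \<mu>) = barycenter (distr \<mu> borel \<phi>)"
      if "1-lipschitz_on UNIV \<phi> \<and> sigma_equivariant \<sigma> \<phi>" "\<mu> \<in> P1" for \<phi> \<mu>
      using that by (intro barycenter_equivariant) auto
  qed
qed

end
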